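(* Let $\mathcal{H}$ be a hypergraph such that any two distinct hyperedges of $\mathcal{H}$ have empty intersection. Then for any integer $k$ with $1\le k\le\nu(\mathcal{H})$, $$\mathrm{reg}\left(I(\mathcal{H})^{[k]}\right)=\max\{\,|V(M)|-|M| : M\text{ is a generalized }k\text{-admissible matching of }\mathcal{H}\,\}+k=\Big|\bigcup_{\mathcal{E}\in E(\mathcal{H})}\mathcal{E}\Big|-|E(\mathcal{H})|+k.$$
   Context: A (simple) hypergraph $\mathcal{H}$ is a pair $(V(\mathcal{H}),E(\mathcal{H}))$ where $V(\mathcal{H})$ is a finite set and $E(\mathcal{H})$ is a collection of nonempty subsets of $V(\mathcal{H})$ (edges), none of which contains another. For $W\subseteq V(\mathcal{H})$, the induced sub-hypergraph $\mathcal{H}[W]$ has vertex set $W$ and edge set $\{\mathcal{E}\in E(\mathcal{H}) : \mathcal{E}\subseteq W\}$. A matching of $\mathcal{H}$ is a set $M$ of pairwise disjoint edges; $V(M)$ is the union of the edges in $M$; $\nu(\mathcal{H})$ is the maximum size of a matching. Identify $V(\mathcal{H})=\{x_1,\dots,x_n\}$ with the variables of $R=\mathbb{K}[x_1,\dots,x_n]$, $\mathbb{K}$ a field. The edge ideal is $I(\mathcal{H})=\langle \prod_{x\in\mathcal{E}}x : \mathcal{E}\in E(\mathcal{H})\rangle$. For $k\ge1$, $I(\mathcal{H})^{[k]}$ is the ideal generated by the square-free monomials in $I(\mathcal{H})^k$; equivalently, it is generated by the products of the monomials corresponding to the edges of a matching of size $k$. For a graded ideal $I$, $\mathrm{reg}(I)=\max\{j-i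 : \beta_{i,j}(I)\ne0\}$; $\mathrm{reg}(0)=0$. For $1\le k\le\nu(\mathcal{H})$, a matching $M$ of $\mathcal{H}$ is a generalized $k$-admissible matching if there is a partition $M=M_1\sqcup\cdots\sqcup M_r$ into nonempty parts such that: (1) every edge of $\mathcal{H}[V(M)]$ is an edge of $\mathcal{H}[V(M_i)]$ for some $i\in\{1,\dots,r\}$; (2) $k\le |M|\le r+k-1$; (3) for every $i$ and every matching $M_i'$ of $\mathcal{H}[V(M_i)]$ with $|M_i'|=|M_i|$, one has $V(M_i')=V(M_i)$. *)

theory Defs
  imports
    "HOL-Library.Poly_Mapping"
    "HOL-Library.Disjoint_Sets"
    "HOL-Algebra.Ideal_Product"
    "Jordan_Normal_Form.Matrix_Kernel"
begin

section \<open>Hypergraphs and matchings\<close>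

record 'v hypergraph =
  verts :: "'v set"
  edges :: "'v set set"

definition hypergraph :: "'v hypergraph \<Rightarrow> bool" where
  "hypergraph H \<longleftrightarrow> finite (verts H)
     \<and> (\<forall>e\<in>edges H. e \<noteq> {} \<and> e \<subseteq> verts H)
     \<and> (\<forall>e\<in>edges H. \<forall>f\<in>edges H. e \<subseteq> f \<longrightarrow> e = f)"

definition induced :: "'v hypergraph \<Rightarrow> 'v set \<Rightarrow> 'v hypergraph" where
  "induced H W = \<lparr>verts = W, edges = {e \<in> edges H. e \<subseteq> W}\<rparr>"

definition matching :: "'v hypergraph \<Rightarrow> 'v set set \<Rightarrow> bool" where
  "matching H M \<longleftrightarrow> M \<subseteq> edges H \<and> pairwise disjnt M"

definition matching_number :: "'v hypergraph \<Rightarrow> nat" where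
  "matching_number H = Max {card M | M. matching H M}"

text \<open>A partition \<open>M = M\<^sub>1 \<squnion> \<dots> \<squnion> M\<^sub>r\<close> into nonempty parts is the set \<open>P\<close> of its parts, so
  \<open>r = card P\<close>. The vertex set \<open>V(M)\<close> of a matching is \<open>\<Union>M\<close>. The subtraction on \<open>nat\<close> below is
  harmless because the notion is only used for \<open>k \<ge> 1\<close>.\<close>

definition generalized_admissible_matching :: "'v hypergraph \<Rightarrow> nat \<Rightarrow> 'v set set \<Rightarrow> bool" where
  "generalized_admissible_matching H k M \<longleftrightarrow> matching H M \<and>
     (\<exists>P. partition_on M P
        \<and> (\<forall>e \<in> edges (induced H (\<Union>M)). \<exists>N\<in>P. e \<in> edges (induced H (\<Union>N)))
        \<and> k \<le> card M \<and> card M \<le> card P + k - 1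
        \<and> (\<forall>N\<in>P. \<forall>N'. matching (induced H (\<Union>N)) N' \<and> card N' = card N \<longrightarrow> \<Union>N' = \<Union>N))"


section \<open>Polynomial rings\<close>

text \<open>A monomial is a finitely supported exponent function \<open>'v \<Rightarrow>\<^sub>0 nat\<close>; multiplication of
  \<open>mpoly\<close> is the convolution product of \<open>HOL-Library.Poly_Mapping\<close>.\<close>

type_synonym ('v, 'k) mpoly = "('v \<Rightarrow>\<^sub>0 nat) \<Rightarrow>\<^sub>0 'k"

text \<open>The ring \<open>K[x\<^sub>v : v \<in> V]\<close>, where the field \<open>K\<close> is the type \<open>'k\<close>.\<close>

definition mpoly_ring :: "'v set \<Rightarrow> ('v, 'k::field) mpoly ring" where
  "mpoly_ring V =
     \<lparr>carrier = {p. \<forall>m \<in> Poly_Mapping.keys p. Poly_Mapping.keys m \<subseteq> V},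
      mult = (*), one = 1, zero = 0, add = (+)\<rparr>"

definition monom_deg :: "('v \<Rightarrow>\<^sub>0 nat) \<Rightarrow> nat" where
  "monom_deg m = (\<Sum>v \<in> Poly_Mapping.keys m. Poly_Mapping.lookup m v)"

text \<open>The zero polynomial is homogeneous of every degree, and the only one of negative degree.\<close>

definition homogeneous :: "int \<Rightarrow> ('v, 'k::field) mpoly \<Rightarrow> bool" where
  "homogeneous d p \<longleftrightarrow> (\<forall>m \<in> Poly_Mapping.keys p. int (monom_deg m) = d)"

definition indet :: "'v \<Rightarrow> ('v, 'k::field) mpoly" where
  "indet v = Poly_Mapping.single (Poly_Mapping.single v 1) 1"

definition squarefree_monomial :: "('v, 'k::field) mpoly \<Rightarrow> bool" where
  "squarefree_monomial p \<longleftrightarrow>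
     (\<exists>m. p = Poly_Mapping.single m 1 \<and> (\<forall>v. Poly_Mapping.lookup m v \<le> 1))"

lemma mpoly_ring_simps:
  "p \<in> carrier (mpoly_ring V) \<longleftrightarrow>
     (\<forall>m \<in> Poly_Mapping.keys p. Poly_Mapping.keys m \<subseteq> V)"
  "p \<otimes>\<^bsub>mpoly_ring V\<^esub> q = p * q" "\<one>\<^bsub>mpoly_ring V\<^esub> = 1"
  "p \<oplus>\<^bsub>mpoly_ring V\<^esub> q = p + q" "\<zero>\<^bsub>mpoly_ring V\<^esub> = 0"
  by (simp_all add: mpoly_ring_def)

lemma mpoly_ring_closed:
  "0 \<in> carrier (mpoly_ring V)" "1 \<in> carrier (mpoly_ring V)"
  "p \<in> carrier (mpoly_ring V) \<Longrightarrow> - p \<in> carrier (mpoly_ring V)"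
  "p \<in> carrier (mpoly_ring V) \<Longrightarrow> q \<in> carrier (mpoly_ring V)
     \<Longrightarrow> p + q \<in> carrier (mpoly_ring V)"
  "p \<in> carrier (mpoly_ring V) \<Longrightarrow> q \<in> carrier (mpoly_ring V)
     \<Longrightarrow> p * q \<in> carrier (mpoly_ring V)"
proof -
  show "p + q \<in> carrier (mpoly_ring V)"
    if "p \<in> carrier (mpoly_ring V)" "q \<in> carrier (mpoly_ring V)"
    using that Poly_Mapping.keys_add[of p q] unfolding mpoly_ring_simps by blast
  show "p * q \<in> carrier (mpoly_ring V)"
    if p: "p \<in> carrier (mpoly_ring V)" and q: "q \<in> carrier (mpoly_ring V)"
    unfolding mpoly_ring_simps
  proof
    fix m assume "m \<in> Poly_Mapping.keys (p * q)"
    then obtain a b where "a \<in> Poly_Mapping.keys p" "b \<in> Poly_Mapping.keys q" "m = a + b"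
      using Poly_Mapping.keys_mult[of p q] by blast
    then show "Poly_Mapping.keys m \<subseteq> V"
      using p q Poly_Mapping.keys_add[of a b] unfolding mpoly_ring_simps by blast
  qed
qed (simp_all add: mpoly_ring_simps(1))

lemma mpoly_ring_cring: "cring (mpoly_ring V)"
proof (rule cringI)
  show "abelian_group (mpoly_ring V)"
  proof (rule abelian_groupI, unfold mpoly_ring_simps(2-))
    fix p assume "p \<in> carrier (mpoly_ring V)"
    then show "\<exists>q\<in>carrier (mpoly_ring V). q + p = 0"
      using mpoly_ring_closed(3) by (metis ab_left_minus)
  qed (simp_all only: mpoly_ring_closed ac_simps add_0_left add_0_right)
  show "comm_monoid (mpoly_ring V)"
    by (rule comm_monoidI, unfold mpoly_ring_simps(2-))
       (simp_all only: mpoly_ring_closed ac_simps mult_1_left mult_1_right)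
qed (simp only: mpoly_ring_simps(2-) distrib_right)


section \<open>Edge ideals and their square-free powers\<close>

definition edge_ideal :: "'v hypergraph \<Rightarrow> ('v, 'k::field) mpoly set" where
  "edge_ideal H = Idl\<^bsub>mpoly_ring (verts H)\<^esub> {\<Prod>v\<in>e. indet v | e. e \<in> edges H}"

text \<open>\<open>I\<^sup>[\<^sup>k\<^sup>]\<close>: the ideal generated by the square-free monomials in the ordinary power \<open>I\<^sup>k\<close>, which
  is taken in the multiplicative monoid of ideals of the ring.\<close>

definition squarefree_power ::
    "'v set \<Rightarrow> ('v, 'k::field) mpoly set \<Rightarrow> nat \<Rightarrow> ('v, 'k) mpoly set" where
  "squarefree_power V I k =
     Idl\<^bsub>mpoly_ring V\<^esub> {p \<in> I [^]\<^bsub>ideals_set (mpoly_ring V)\<^esub> k. squarefree_monomial p}"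


section \<open>Minimal graded free resolutions, graded Betti numbers and regularity\<close>

text \<open>For \<open>R = K[x\<^sub>v : v \<in> V]\<close>, the elements of the free module \<open>R\<^sup>n\<close>.\<close>

definition free_mod :: "'v set \<Rightarrow> nat \<Rightarrow> ('v, 'k::field) mpoly vec set" where
  "free_mod V n = {u \<in> carrier_vec n. set\<^sub>v u \<subseteq> carrier (mpoly_ring V)}"

text \<open>A list \<open>[d\<^sub>1, \<dots>, d\<^sub>n]\<close> of integers stands for the graded free module
  \<open>R(-d\<^sub>1) \<oplus> \<dots> \<oplus> R(-d\<^sub>n)\<close>. The matrix \<open>A\<close> of a degree preserving homomorphism from the module
  given by \<open>ds\<close> to the one given by \<open>ds'\<close> acts on column vectors.\<close>

definition graded_hom :: "'v set \<Rightarrow> int list \<Rightarrow> int list \<Rightarrow> ('v, 'k::field) mpoly mat \<Rightarrow> bool" where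
  "graded_hom V ds ds' A \<longleftrightarrow> A \<in> carrier_mat (length ds') (length ds)
     \<and> elements_mat A \<subseteq> carrier (mpoly_ring V)
     \<and> (\<forall>p < length ds'. \<forall>q < length ds. homogeneous (ds ! q - ds' ! p) (A $$ (p, q)))"

text \<open>A minimal graded free resolution
  \<open>\<dots> \<rightarrow> F\<^sub>2 \<rightarrow> F\<^sub>1 \<rightarrow> F\<^sub>0 \<rightarrow> I \<rightarrow> 0\<close> with finitely generated \<open>F\<^sub>i\<close>, where \<open>F\<^sub>i\<close> is given by the
  degree list \<open>d i\<close> and \<open>\<phi> i\<close> is the matrix of the map \<open>F\<^sub>i \<rightarrow> F\<^sub>i\<^sub>-\<^sub>1\<close>. The map \<open>F\<^sub>0 \<rightarrow> I\<close> is
  regarded as a map \<open>\<phi> 0\<close> into \<open>R = R(0)\<close> with image \<open>I\<close>. Minimality says that the matrices of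
  the maps \<open>F\<^sub>i\<^sub>+\<^sub>1 \<rightarrow> F\<^sub>i\<close> have entries in the maximal ideal \<open>\<langle>x\<^sub>v : v \<in> V\<rangle>\<close>, that is, entries with
  zero constant coefficient.\<close>

definition minimal_graded_free_resolution ::
    "'v set \<Rightarrow> ('v, 'k::field) mpoly set \<Rightarrow> (nat \<Rightarrow> int list) \<Rightarrow> (nat \<Rightarrow> ('v, 'k) mpoly mat) \<Rightarrow> bool"
  where
  "minimal_graded_free_resolution V I d \<phi> \<longleftrightarrow>
       graded_hom V (d 0) [0] (\<phi> 0)
     \<and> (\<forall>i. graded_hom V (d (Suc i)) (d i) (\<phi> (Suc i)))
     \<and> {(\<phi> 0 *\<^sub>v u) $ 0 | u. u \<in> free_mod V (length (d 0))} = I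
     \<and> (\<forall>i. mat_kernel (\<phi> i) \<inter> free_mod V (length (d i))
            = (\<lambda>u. \<phi> (Suc i) *\<^sub>v u) ` free_mod V (length (d (Suc i))))
     \<and> (\<forall>i. \<forall>a \<in> elements_mat (\<phi> (Suc i)). Poly_Mapping.lookup a 0 = 0)"

text \<open>\<open>\<beta>\<^sub>i\<^sub>,\<^sub>j(I)\<close> is the number of summands \<open>R(-j)\<close> of \<open>F\<^sub>i\<close> in the minimal graded free resolution,
  which exists and is unique up to isomorphism for a graded ideal \<open>I\<close> of \<open>R\<close> (\<open>V\<close> finite).\<close>

definition betti :: "'v set \<Rightarrow> ('v, 'k::field) mpoly set \<Rightarrow> nat \<Rightarrow> int \<Rightarrow> nat" where
  "betti V I i j =
     (THE b. \<exists>d \<phi>. minimal_graded_free_resolution V I d \<phi> \<and> b = count_list (d i) j)"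

definition reg :: "'v set \<Rightarrow> ('v, 'k::field) mpoly set \<Rightarrow> int" where
  "reg V I = (if I = {0} then 0 else Max {j - int i | i j. betti V I i j \<noteq> 0})"

end

theory Submission
  imports Defs "Jordan_Normal_Form.Determinant"
begin

text \<open>Let \<open>E\<^sub>1, \<dots>, E\<^sub>n\<close> be the edges and \<open>f\<^sub>j\<close> the monomial of \<open>E\<^sub>j\<close>. The \<open>f\<^sub>j\<close> involve disjoint sets of
  variables, so \<open>I\<^sup>[\<^sup>k\<^sup>]\<close> is the square-free Veronese ideal of degree \<open>k\<close> in \<open>f\<^sub>1, \<dots>, f\<^sub>n\<close>. Its minimal
  resolution is known: in step \<open>i\<close> and multidegree \<open>\<Prod>j\<in>S. f\<^sub>j\<close> with \<open>|S| = k + i\<close> it consists of the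
  cocycles of the full simplex on \<open>S\<close> living on the faces with \<open>k\<close> vertices, and the differential
  restricts cocycles to the facets \<open>S - {j}\<close> with the signs of the Koszul complex. Every such \<open>S\<close> gives the
  value \<open>(\<Sum>j\<in>S. |E\<^sub>j|) - i = (\<Sum>j\<in>S. (|E\<^sub>j| - 1)) + k\<close>, which is largest for \<open>S = {1, \<dots>, n}\<close>.
  In the same way \<open>|V(M)| - |M|\<close> is a sum of nonnegative terms over the edges of \<open>M\<close>, so the set of all
  edges, partitioned into singletons, is an optimal admissible matching. Minimal graded free
  resolutions are compared by lifting chain maps and a homotopy; modulo the variables the homotopy
  vanishes.\<close>

section \<open>Cocycles of a simplex\<close>

text \<open>In a fixed multidegree \<open>m\<close> the complex consists of scalars and depends only
  on the set \<open>A\<close> of edges contained in the support of \<open>m\<close>. Exactness thus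
  becomes a statement about finite sets of numbers, valid over every commutative ring, and
  polynomials enter only when the strands are put together. The obstacle is that a resolution has to
  be given by matrices, while cocycles are defined by equations. A simplex is a cone over its least
  vertex, so a cocycle on a nonempty \<open>S\<close> is determined by its values on the faces
  through \<open>Min S\<close>, and these values are arbitrary. Such faces index a basis, of
  \<open>binomial (k + i - 1) (k - 1)\<close> elements for each \<open>S\<close> with
  \<open>k + i\<close> elements, and a matrix entry is the value of a cocycle on a face. The cone
  point varies with \<open>S\<close>, so exactness is proved for cocycles and only then translated
  into coordinates. The graded Betti numbers are defined by a definite description, so an explicit
  resolution yields them only together with the comparison of any two minimal ones.\<close>

definition sgn_pos :: "nat \<Rightarrow> nat set \<Rightarrow> 'a::comm_ring_1" where
  "sgn_pos j S = (- 1) ^ card {x \<in> S. x < j}"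

text \<open>Removing the smaller vertex \<open>i\<close> lowers the position of \<open>j\<close> by
  one, while removing \<open>j\<close> leaves that of \<open>i\<close> alone; this makes one factor
  -1 in total.\<close>

lemma sgn_pos_swap_less:
  assumes "finite S" "i \<in> S" "j \<in> S" "i < j"
  shows "sgn_pos i S * sgn_pos j (S - {i}) = - (sgn_pos j S * sgn_pos i (S - {j}) :: 'a::comm_ring_1)"
proof -
  have "{x \<in> S. x < j} = insert i {x \<in> S - {i}. x < j}" using assms by auto
  then have "card {x \<in> S. x < j} = Suc (card {x \<in> S - {i}. x < j})"
    using assms(1) by simp
  moreover have "{x \<in> S - {j}. x < i} = {x \<in> S. x < i}" using assms by auto
  ultimately show ?thesis by (simp add: sgn_pos_def)
qed

lemma sgn_pos_swap:
  assumes "finite S" "i \<in> S" "j \<in> S" "i \<noteq> j"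
  shows "sgn_pos i S * sgn_pos j (S - {i}) = - (sgn_pos j S * sgn_pos i (S - {j}) :: 'a::comm_ring_1)"
proof (cases "i < j")
  case True
  then show ?thesis by (rule sgn_pos_swap_less[OF assms(1-3)])
next
  case False
  then have "j < i" using assms(4) by simp
  from sgn_pos_swap_less[OF assms(1,3,2) this]
  show ?thesis by (metis add.inverse_inverse)
qed

lemma sgn_pos_least: "\<forall>x\<in>S. c \<le> x \<Longrightarrow> sgn_pos c S = 1"
proof -
  assume "\<forall>x\<in>S. c \<le> x"
  then have "{x \<in> S. x < c} = {}" by force
  then show ?thesis by (simp add: sgn_pos_def del: Collect_empty_eq)
qed

lemma sgn_pos_insert_least:
  assumes "finite S" "\<forall>x\<in>S. c < x" "c < j"
  shows "sgn_pos j (insert c S) = - sgn_pos j S"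
proof -
  have "{x \<in> insert c S. x < j} = insert c {x \<in> S. x < j}" using assms by auto
  moreover have "c \<notin> {x \<in> S. x < j}" using assms by auto
  ultimately show ?thesis using assms by (simp add: sgn_pos_def)
qed

text \<open>The pairs are split at the diagonal and one half is matched with the negative of the
  other. Showing only that the sum equals its own negative would not suffice in characteristic
  two.\<close>

lemma sum_antisymmetric:
  fixes f :: "nat \<Rightarrow> nat \<Rightarrow> 'a::ab_group_add"
  assumes fin: "finite W"
    and anti: "\<And>v w. v \<in> W \<Longrightarrow> w \<in> W \<Longrightarrow> v \<noteq> w \<Longrightarrow> f v w = - f w v"
  shows "(\<Sum>w\<in>W. \<Sum>v\<in>W - {w}. f w v) = 0"
proof -
  have fin': "finite {(w, v). w \<in> W \<and> v \<in> W \<and> w < v}" "finite {(w, v). w \<in> W \<and> v \<in> W \<and> v < w}"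
    by (rule finite_subset[of _ "W \<times> W"], use fin in auto)+
  have "(\<Sum>w\<in>W. \<Sum>v\<in>W - {w}. f w v) = (\<Sum>(w, v)\<in>Sigma W (\<lambda>w. W - {w}). f w v)"
    using fin by (simp add: sum.Sigma)
  also have "Sigma W (\<lambda>w. W - {w}) = {(w, v). w \<in> W \<and> v \<in> W \<and> w < v} \<union> {(w, v). w \<in> W \<and> v \<in> W \<and> v < w}"
    by auto
  also have "(\<Sum>(w, v)\<in>\<dots>. f w v) = (\<Sum>(w, v)\<in>{(w, v). w \<in> W \<and> v \<in> W \<and> w < v}. f w v)
      + (\<Sum>(w, v)\<in>{(w, v). w \<in> W \<and> v \<in> W \<and> v < w}. f w v)"
    by (rule sum.union_disjoint[OF fin']) auto
  also have "(\<Sum>(w, v)\<in>{(w, v). w \<in> W \<and> v \<in> W \<and> v < w}. f w v)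
      = (\<Sum>(w, v)\<in>{(w, v). w \<in> W \<and> v \<in> W \<and> w < v}. - f w v)"
    by (rule sum.reindex_bij_witness[of _ "\<lambda>(w, v). (v, w)" "\<lambda>(w, v). (v, w)"])
       (auto dest: anti)
  also have "\<dots> = - (\<Sum>(w, v)\<in>{(w, v). w \<in> W \<and> v \<in> W \<and> w < v}. f w v)"
    by (simp add: sum_negf case_prod_unfold)
  finally show ?thesis by simp
qed

definition cobd :: "(nat set \<Rightarrow> 'a::comm_ring_1) \<Rightarrow> nat set \<Rightarrow> 'a" where
  "cobd z W = (\<Sum>w\<in>W. sgn_pos w W * z (W - {w}))"

text \<open>A cochain on the full simplex with vertex set \<open>S\<close> is indexed by the number \<open>k\<close> of vertices of
  the faces on which it lives, so the empty face is the only one for \<open>k = 0\<close>.\<close>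

definition cocycle :: "nat \<Rightarrow> nat set \<Rightarrow> (nat set \<Rightarrow> 'a::comm_ring_1) \<Rightarrow> bool" where
  "cocycle k S z \<longleftrightarrow> (\<forall>W\<subseteq>S. card W = Suc k \<longrightarrow> cobd z W = 0)"

lemma cobd_cobd:
  assumes "finite W"
  shows "cobd (cobd z) W = 0"
proof -
  have "cobd (cobd z) W
      = (\<Sum>w\<in>W. \<Sum>v\<in>W - {w}. sgn_pos w W * sgn_pos v (W - {w}) * z (W - {w} - {v}))"
    by (simp add: cobd_def sum_distrib_left mult.assoc)
  also have "\<dots> = 0"
  proof (rule sum_antisymmetric[OF assms])
    fix v w assume "v \<in> W" "w \<in> W" "v \<noteq> w"
    moreover have "W - {w} - {v} = W - {v} - {w}" by auto
    ultimately show "sgn_pos v W * sgn_pos w (W - {v}) * z (W - {v} - {w}) =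
      - (sgn_pos w W * sgn_pos v (W - {w}) * z (W - {w} - {v}))"
      using sgn_pos_swap[of W v w, OF assms] by (metis mult_minus_left)
  qed
  finally show ?thesis .
qed

text \<open>The least vertex has sign 1, and its presence reverses the sign of every other vertex.
  All cone arguments rest on this formula.\<close>

lemma cobd_insert_least:
  assumes "finite T" "\<forall>x\<in>T. c < x"
  shows "cobd z (insert c T) = z T - cobd (\<lambda>U. z (insert c U)) T"
proof -
  have "c \<notin> T" using assms by auto
  have "cobd z (insert c T) = sgn_pos c (insert c T) * z T
      + (\<Sum>w\<in>T. sgn_pos w (insert c T) * z (insert c T - {w}))"
    using assms \<open>c \<notin> T\<close> unfolding cobd_def by (subst sum.insert) auto
  also have "sgn_pos c (insert c T) = (1::'a)"
    using assms by (intro sgn_pos_least) (auto simp: less_imp_le)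
  also have "(\<Sum>w\<in>T. sgn_pos w (insert c T) * z (insert c T - {w}))
      = (\<Sum>w\<in>T. - (sgn_pos w T * z (insert c (T - {w}))))"
    using assms \<open>c \<notin> T\<close> by (auto intro!: sum.cong simp: sgn_pos_insert_least insert_Diff_if)
  finally show ?thesis by (simp add: cobd_def sum_negf)
qed

lemma cobd_cong: "(\<And>w. w \<in> W \<Longrightarrow> y (W - {w}) = z (W - {w})) \<Longrightarrow> cobd y W = cobd z W"
  by (simp add: cobd_def)

lemma cobd_diff: "cobd (\<lambda>U. y U - z U) W = cobd y W - cobd z W"
  by (simp add: cobd_def right_diff_distrib sum_subtractf)

lemma cobd_sum: "cobd (\<lambda>U. \<Sum>q\<in>Q. f q U * t q) W = (\<Sum>q\<in>Q. cobd (f q) W * t q)"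
  unfolding cobd_def sum_distrib_left sum_distrib_right mult.assoc by (rule sum.swap)

lemma cocycle_diff: "cocycle k S y \<Longrightarrow> cocycle k S z \<Longrightarrow> cocycle k S (\<lambda>U. y U - z U)"
  by (simp add: cocycle_def cobd_diff)

lemma Min_less_of_notin:
  assumes "finite S" "U \<subseteq> S" "Min S \<notin> U" "x \<in> U"
  shows "Min S < x"
  using assms by (metis Min_le order_le_less subsetD)

lemma cocycleD: "cocycle k S z \<Longrightarrow> W \<subseteq> S \<Longrightarrow> card W = Suc k \<Longrightarrow> cobd z W = 0"
  by (simp add: cocycle_def)

lemma cocycle_zero: "(\<And>U. U \<subseteq> S \<Longrightarrow> z U = 0) \<Longrightarrow> cocycle k S z"
  unfolding cocycle_def cobd_def
proof (intro allI impI sum.neutral ballI)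
  fix W w assume "\<And>U. U \<subseteq> S \<Longrightarrow> z U = 0" "W \<subseteq> S"
  then have "z (W - {w}) = 0" by (metis Diff_subset order_trans)
  then show "sgn_pos w W * z (W - {w}) = 0" by simp
qed

text \<open>The full simplex is a cone over its least vertex.\<close>

lemma cocycle_cone:
  assumes "finite S" "cocycle k S z" "U \<subseteq> S" "card U = k" "S \<noteq> {}" "Min S \<notin> U"
  shows "z U = cobd (\<lambda>T. z (insert (Min S) T)) U"
proof -
  have "finite U" using assms finite_subset by blast
  have "cobd z (insert (Min S) U) = 0"
    using assms \<open>finite U\<close> by (auto simp: cocycle_def)
  then show ?thesis
    using cobd_insert_least[of U "Min S" z] Min_less_of_notin[of S U] assms \<open>finite U\<close> by simp
qed

text \<open>Values prescribed on the faces through \<open>Min S\<close> are extended to the other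
  faces in the only way that \<open>cocycle_cone\<close> permits.\<close>

definition cone_ext :: "nat set \<Rightarrow> (nat set \<Rightarrow> 'a::comm_ring_1) \<Rightarrow> nat set \<Rightarrow> 'a" where
  "cone_ext S t U = (if Min S \<in> U then t U else cobd (\<lambda>T. t (insert (Min S) T)) U)"

text \<open>At a set through the cone point the cocycle condition is the definition of
  \<open>cone_ext\<close>; at any other set it is the vanishing of a double coboundary.\<close>

lemma cocycle_cone_ext:
  assumes "finite S"
  shows "cocycle k S (cone_ext S t)"
  unfolding cocycle_def
proof (intro allI impI)
  fix W assume W: "W \<subseteq> S" "card W = Suc k"
  let ?a = "Min S"
  have fin: "finite W" using W assms finite_subset by blast
  show "cobd (cone_ext S t) W = 0"
  proof (cases "?a \<in> W")
    case True
    let ?T = "W - {?a}"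
    have T: "insert ?a ?T = W" "finite ?T" "\<forall>x\<in>?T. ?a < x"
      using True fin Min_less_of_notin[OF assms, of ?T] W by auto
    have "cobd (cone_ext S t) W = cone_ext S t ?T - cobd (\<lambda>U. cone_ext S t (insert ?a U)) ?T"
      using cobd_insert_least[OF T(2,3), of "cone_ext S t"] T(1) by simp
    then show ?thesis by (simp add: cone_ext_def)
  next
    case False
    have "cobd (cone_ext S t) W = cobd (cobd (\<lambda>T. t (insert ?a T))) W"
      using False by (intro cobd_cong) (simp add: cone_ext_def)
    then show ?thesis using cobd_cobd[OF fin] by simp
  qed
qed

text \<open>Contraction to the least vertex: the primitive at \<open>T\<close> is the value of
  \<open>z\<close> at \<open>insert (Min S) T\<close>, set to 0 on faces that already contain
  \<open>Min S\<close>.\<close>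

lemma cocycle_primitive:
  assumes "finite S" "S \<noteq> {}" "cocycle k S z"
  shows "\<exists>w. \<forall>U\<subseteq>S. card U = k \<longrightarrow> cobd w U = z U"
proof (intro exI allI impI)
  let ?a = "Min S"
  let ?w = "\<lambda>T. if ?a \<in> T then 0 else z (insert ?a T)"
  fix U assume U: "U \<subseteq> S" "card U = k"
  have fin: "finite U" using U assms finite_subset by blast
  show "cobd ?w U = z U"
  proof (cases "?a \<in> U")
    case True
    let ?T = "U - {?a}"
    have T: "insert ?a ?T = U" "finite ?T" "\<forall>x\<in>?T. ?a < x"
      using True fin Min_less_of_notin[OF assms(1), of ?T] U by auto
    have "cobd ?w U = ?w ?T - cobd (\<lambda>U. ?w (insert ?a U)) ?T"
      using cobd_insert_least[OF T(2,3), of ?w] T(1) by simp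
    then show ?thesis using T(1) by (simp add: cobd_def)
  next
    case False
    have "z U = cobd (\<lambda>T. z (insert ?a T)) U"
      using cocycle_cone[OF assms(1,3) U assms(2) False] .
    also have "\<dots> = cobd ?w U"
      using False by (intro cobd_cong) simp
    finally show ?thesis by simp
  qed
qed


section \<open>The strands\<close>

text \<open>A chain on \<open>A\<close> assigns to every \<open>S \<subseteq> A\<close> of a fixed size a cochain on the simplex \<open>S\<close>; the
  differential restricts cochains to facets, with the signs of the Koszul complex.\<close>

definition restr_diff :: "nat set \<Rightarrow> (nat set \<Rightarrow> nat set \<Rightarrow> 'a::comm_ring_1) \<Rightarrow> nat set \<Rightarrow> nat set \<Rightarrow> 'a" where
  "restr_diff A y S U = (\<Sum>j\<in>A - S. sgn_pos j (insert j S) * y (insert j S) U)"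

text \<open>The two orders of adding a pair of vertices lead to the same simplex with opposite
  signs.\<close>

lemma restr_diff_restr_diff:
  assumes "finite A" "S \<subseteq> A"
  shows "restr_diff A (restr_diff A y) S U = 0"
proof -
  have fin: "finite S" using assms finite_subset by blast
  have "restr_diff A (restr_diff A y) S U
      = (\<Sum>i\<in>A - S. \<Sum>j\<in>A - S - {i}. sgn_pos i (insert i S) * sgn_pos j (insert j (insert i S)) * y (insert j (insert i S)) U)"
    unfolding restr_diff_def sum_distrib_left mult.assoc
    by (intro sum.cong) auto
  also have "\<dots> = 0"
  proof (rule sum_antisymmetric)
    fix v w assume vw: "v \<in> A - S" "w \<in> A - S" "v \<noteq> w"
    let ?T = "insert v (insert w S)"
    have eq: "insert v S = ?T - {w}" "insert w S = ?T - {v}" "finite ?T"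
      using vw fin by auto
    have "sgn_pos w ?T * sgn_pos v (?T - {w}) = (- (sgn_pos v ?T * sgn_pos w (?T - {v})) :: 'a)"
      using sgn_pos_swap[of ?T w v] vw fin by simp
    then have "sgn_pos v (insert v S) * sgn_pos w ?T = (- (sgn_pos w (insert w S) * sgn_pos v ?T) :: 'a)"
      unfolding eq(1,2)[symmetric] by (simp add: mult.commute)
    then show "sgn_pos v (insert v S) * sgn_pos w (insert w (insert v S)) * y (insert w (insert v S)) U
      = - (sgn_pos w (insert w S) * sgn_pos v (insert v (insert w S)) * y (insert v (insert w S)) U)"
      by (simp add: insert_commute[of w v])
  qed (use assms in simp)
  finally show ?thesis .
qed

text \<open>The coboundary acts on the face and the differential on the simplex, so they commute.
  Hence families of cocycles form a subcomplex.\<close>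

lemma cobd_restr_diff:
  "cobd (restr_diff A y S) W = (\<Sum>j\<in>A - S. sgn_pos j (insert j S) * cobd (y (insert j S)) W)"
  unfolding cobd_def restr_diff_def sum_distrib_left
  by (subst sum.swap) (simp add: mult.left_commute)

lemma restr_diff_cong:
  "(\<And>j. j \<in> A - S \<Longrightarrow> y (insert j S) U = z (insert j S) U) \<Longrightarrow> restr_diff A y S U = restr_diff A z S U"
  by (simp add: restr_diff_def)

lemma restr_diff_diff:
  "restr_diff A (\<lambda>S U. y S U - z S U) S U = restr_diff A y S U - restr_diff A z S U"
  by (simp add: restr_diff_def right_diff_distrib sum_subtractf)

lemma cocycle_restr_diff:
  assumes "\<And>j. j \<in> A - S \<Longrightarrow> cocycle k (insert j S) (y (insert j S))"
  shows "cocycle k S (restr_diff A y S)"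
  unfolding cocycle_def cobd_restr_diff
  using assms by (auto simp: cocycle_def subset_insertI2)

text \<open>A simplex with \<open>k\<close> vertices has itself as its only face with
  \<open>k\<close> vertices, so a chain at the lowest level is one scalar per \<open>S\<close>. This
  is the map from the generators of the ideal to \<open>R\<close>, seen in one multidegree.\<close>

definition augment :: "nat \<Rightarrow> nat set \<Rightarrow> (nat set \<Rightarrow> nat set \<Rightarrow> 'a::comm_ring_1) \<Rightarrow> 'a" where
  "augment k A y = (\<Sum>S | S \<subseteq> A \<and> card S = k. y S S)"

text \<open>Regrouping the sum by \<open>T = insert j S\<close> turns it into a sum of coboundaries
  of \<open>y T\<close> at \<open>T\<close> itself, where the cocycle condition applies.\<close>

lemma augment_restr_diff:
  assumes A: "finite A"
    and y: "\<And>S. S \<subseteq> A \<Longrightarrow> card S = Suc k \<Longrightarrow> cocycle k S (y S)"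
  shows "augment k A (restr_diff A y) = 0"
proof -
  have fin: "finite S" if "S \<subseteq> A" for S using that A finite_subset by blast
  have "augment k A (restr_diff A y)
      = (\<Sum>(S, j)\<in>Sigma {S. S \<subseteq> A \<and> card S = k} (\<lambda>S. A - S). sgn_pos j (insert j S) * y (insert j S) S)"
    unfolding augment_def restr_diff_def using A by (subst sum.Sigma) auto
  also have "\<dots> = (\<Sum>(T, j)\<in>Sigma {T. T \<subseteq> A \<and> card T = Suc k} (\<lambda>T. T). sgn_pos j T * y T (T - {j}))"
    by (rule sum.reindex_bij_witness[of _ "\<lambda>(T, j). (T - {j}, j)" "\<lambda>(S, j). (insert j S, j)"])
       (auto simp: fin insert_absorb)
  also have "\<dots> = (\<Sum>T | T \<subseteq> A \<and> card T = Suc k. cobd (y T) T)"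
    unfolding cobd_def using A fin by (subst sum.Sigma) auto
  also have "\<dots> = 0" using y by (auto simp: cocycle_def)
  finally show ?thesis .
qed

text \<open>The least vertex has sign 1 when it is the vertex added, and reverses all other signs
  when it is already present.\<close>

lemma restr_diff_remove_least:
  assumes A: "finite A" "c \<in> A" "\<forall>x\<in>A. c \<le> x" and S: "S \<subseteq> A - {c}"
  shows "restr_diff A y (insert c S) U = - restr_diff (A - {c}) (\<lambda>T. y (insert c T)) S U"
    and "restr_diff A y S U = y (insert c S) U + restr_diff (A - {c}) y S U"
proof -
  have fin: "finite S" using A S by (meson finite_Diff finite_subset)
  have lt: "c < x" if "x \<in> A - {c}" for x using A that by (metis Diff_iff insertI1 order_le_less)
  have "sgn_pos j (insert j (insert c S)) = (- sgn_pos j (insert j S) :: 'a)" if "j \<in> A - {c} - S" for j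
  proof -
    have "insert j (insert c S) = insert c (insert j S)" by auto
    then show ?thesis using sgn_pos_insert_least[of "insert j S" c j] fin lt S that by auto
  qed
  then show "restr_diff A y (insert c S) U = - restr_diff (A - {c}) (\<lambda>T. y (insert c T)) S U"
    unfolding restr_diff_def
    by (subst sum_negf[symmetric]) (rule sum.cong, auto simp: insert_commute)
  have "A - S = insert c (A - {c} - S)" using A S by auto
  moreover have "sgn_pos c (insert c S) = (1::'a)"
    using A S by (intro sgn_pos_least) auto
  ultimately show "restr_diff A y S U = y (insert c S) U + restr_diff (A - {c}) y S U"
    using A by (simp add: restr_diff_def)
qed

text \<open>The induction removes the least vertex \<open>c\<close> of \<open>A\<close>: coning over \<open>c\<close> produces a chain with the
  right differential on faces avoiding \<open>c\<close>, and the error lives on the faces through \<open>c\<close>, that is,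
  on cochains with one vertex less on \<open>A - {c}\<close>.\<close>

lemma strand_exact:
  fixes y :: "nat set \<Rightarrow> nat set \<Rightarrow> 'a::comm_ring_1"
  assumes "finite A" "k \<le> s"
    and "\<And>S. S \<subseteq> A \<Longrightarrow> card S = s \<Longrightarrow> cocycle k S (y S)"
    and "\<And>S U. k < s \<Longrightarrow> S \<subseteq> A \<Longrightarrow> Suc (card S) = s \<Longrightarrow> U \<subseteq> S \<Longrightarrow> card U = k \<Longrightarrow> restr_diff A y S U = 0"
    and "s = k \<Longrightarrow> augment k A y = 0"
  shows "\<exists>x. (\<forall>S\<subseteq>A. card S = Suc s \<longrightarrow> cocycle k S (x S)) \<and>
    (\<forall>S\<subseteq>A. \<forall>U\<subseteq>S. card S = s \<longrightarrow> card U = k \<longrightarrow> restr_diff A x S U = y S U)"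
  using assms
proof (induction k arbitrary: A s y)
  case 0
  \<comment> \<open>For \<open>k = 0\<close> only the empty face matters. The coboundary at a single
    vertex equals the value there, so a cocycle on a nonempty simplex vanishes; on the empty simplex
    the augmentation gives 0.\<close>
  have "y S {} = 0" if S: "S \<subseteq> A" "card S = s" for S
  proof (cases "s = 0")
    case True
    have empty: "T \<subseteq> A \<and> card T = 0 \<longleftrightarrow> T = {}" for T
      using "0.prems"(1) finite_subset[of T A] by auto
    then have "{T. T \<subseteq> A \<and> card T = 0} = {{}}" by simp
    then have "augment 0 A y = y {} {}" by (simp add: augment_def)
    moreover have "S = {}" using empty[of S] S True by simp
    ultimately show ?thesis using "0.prems"(5) True by simp
  next
    case False
    then have "S \<noteq> {}" using S(2) by auto
    then obtain v where "v \<in> S" by blast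
    then have "{v} \<subseteq> S" "card {v} = Suc 0" by auto
    then have "cobd (y S) {v} = 0"
      using "0.prems"(3)[OF S] by (metis cocycle_def)
    then show ?thesis by (simp add: cobd_def sgn_pos_least)
  qed
  then have "restr_diff A (\<lambda>_ _. 0) S U = y S U" if "S \<subseteq> A" "U \<subseteq> S" "card S = s" "card U = 0" for S U
    using that "0.prems"(1) finite_subset[of U A] by (simp add: restr_diff_def)
  then show ?case by (intro exI[of _ "\<lambda>_ _. 0"]) (simp add: cocycle_zero)
next
  case (Suc k)
  note y_coc = Suc.prems(3) and y_cyc = Suc.prems(4) and y_aug = Suc.prems(5)
  show ?case
  proof (cases "A = {}")
    case True
    then show ?thesis using Suc.prems(2) by (intro exI[of _ y]) auto
  next
    case False
    define c where "c = Min A"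
    define A' where "A' = A - {c}"
    have c: "c \<in> A" "\<forall>x\<in>A. c \<le> x" using False Suc.prems(1) by (auto simp: c_def)
    have finA': "finite A'" using Suc.prems(1) by (simp add: A'_def)
    have A: "insert c A' = A" "c \<notin> A'" "A' \<subseteq> A" using c by (auto simp: A'_def)
    have fin: "finite S" if "S \<subseteq> A" for S using that Suc.prems(1) finite_subset by blast
    have lt: "\<forall>x\<in>S. c < x" if "S \<subseteq> A'" for S
      using that c by (auto simp: A'_def order_less_le)
    have split: "S - {c} \<subseteq> A'" "insert c (S - {c}) = S" "card S = Suc (card (S - {c}))" "c \<notin> S - {c}"
      if "S \<subseteq> A" "c \<in> S" for S
      using that fin[OF that(1)] card.remove[of S c] by (auto simp: A'_def)
    have cobd_c: "cobd z W = z (W - {c}) - cobd (\<lambda>U. z (insert c U)) (W - {c})"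
      if "W \<subseteq> A" "c \<in> W" for W and z :: "nat set \<Rightarrow> 'a"
      using cobd_insert_least[of "W - {c}" c z] split[OF that] lt fin[OF that(1)] by auto
    have rd_c: "restr_diff A z S U = - restr_diff A' (\<lambda>T. z (insert c T)) (S - {c}) U"
      if "S \<subseteq> A" "c \<in> S" for S U and z :: "nat set \<Rightarrow> nat set \<Rightarrow> 'a"
      using restr_diff_remove_least(1)[OF Suc.prems(1) c, of "S - {c}" z U] split[OF that]
      by (simp add: A'_def)
    have rd_nc: "restr_diff A z S U = z (insert c S) U + restr_diff A' z S U"
      if "S \<subseteq> A'" for S U and z :: "nat set \<Rightarrow> nat set \<Rightarrow> 'a"
      using restr_diff_remove_least(2)[OF Suc.prems(1) c, of S z U] that by (simp add: A'_def)

    have "\<exists>w. \<forall>U\<subseteq>S. card U = Suc k \<longrightarrow> cobd w U = y S U" if S: "S \<subseteq> A'" "card S = s" for S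
    proof -
      have "S \<noteq> {}" using S Suc.prems(2) by auto
      moreover have "finite S" "S \<subseteq> A" using S fin A by auto
      ultimately show ?thesis by (intro cocycle_primitive y_coc S(2))
    qed
    then obtain w where w: "\<And>S U. S \<subseteq> A' \<Longrightarrow> card S = s \<Longrightarrow> U \<subseteq> S \<Longrightarrow> card U = Suc k \<Longrightarrow> cobd (w S) U = y S U"
      by metis
    \<comment> \<open>Only simplices through \<open>c\<close> are used, and on their faces avoiding
      \<open>c\<close> the values of \<open>y\<close> are copied. The cocycle condition at sets
      through \<open>c\<close> then demands a primitive of \<open>y\<close> on the faces through
      \<open>c\<close>, which \<open>w\<close> supplies.\<close>
    define x1 where "x1 S U = (if c \<notin> S then 0 else if c \<notin> U then y (S - {c}) U
      else w (S - {c}) (U - {c}))" for S U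
    have x1_coc: "cocycle (Suc k) S (x1 S)" if S: "S \<subseteq> A" "card S = Suc s" for S
    proof (cases "c \<in> S")
      case False
      then show ?thesis by (intro cocycle_zero) (simp add: x1_def)
    next
      case True
      note S' = split[OF S(1) True]
      have SA: "S - {c} \<subseteq> A" "card (S - {c}) = s" using S S' by auto
      show ?thesis unfolding cocycle_def
      proof (intro allI impI)
        fix W assume W: "W \<subseteq> S" "card W = Suc (Suc k)"
        have WA: "W \<subseteq> A" using W S by auto
        show "cobd (x1 S) W = 0"
        proof (cases "c \<in> W")
          case cW: True
          note W' = split[OF WA cW]
          have "cobd (\<lambda>U. x1 S (insert c U)) (W - {c}) = cobd (w (S - {c})) (W - {c})"
            by (rule cobd_cong) (use True in \<open>auto simp: x1_def insert_Diff_if\<close>)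
          also have "\<dots> = y (S - {c}) (W - {c})"
            using W W' S' SA by (intro w) auto
          finally show ?thesis
            using cobd_c[OF WA cW, of "x1 S"] True by (simp add: x1_def)
        next
          case cW: False
          have "cobd (x1 S) W = cobd (y (S - {c})) W"
            by (rule cobd_cong) (use True cW in \<open>auto simp: x1_def\<close>)
          also have "\<dots> = 0"
            by (rule cocycleD[OF y_coc[OF SA]]) (use W cW in auto)
          finally show ?thesis .
        qed
      qed
    qed
    have x1_diff: "restr_diff A x1 S U = y S U"
      if S: "S \<subseteq> A" "card S = s" and U: "U \<subseteq> S" "card U = Suc k" "c \<notin> U" for S U
    proof (cases "c \<in> S")
      case False
      then have "S \<subseteq> A'" using S A by auto
      moreover have "restr_diff A' x1 S U = 0"
        unfolding restr_diff_def using False A by (intro sum.neutral) (auto simp: x1_def)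
      ultimately show ?thesis using rd_nc[of S x1 U] U False by (simp add: x1_def)
    next
      case True
      note S' = split[OF S(1) True]
      have US: "U \<subseteq> S - {c}" using U by auto
      then have "Suc k \<le> card (S - {c})" using U fin[OF S(1)] card_mono[of "S - {c}" U] by auto
      then have s: "Suc k < s" using S' S by simp
      have "restr_diff A x1 S U = - restr_diff A' (\<lambda>T. x1 (insert c T)) (S - {c}) U"
        by (rule rd_c[OF S(1) True])
      also have "restr_diff A' (\<lambda>T. x1 (insert c T)) (S - {c}) U = restr_diff A' y (S - {c}) U"
        by (rule restr_diff_cong) (use U A in \<open>auto simp: x1_def insert_Diff_if\<close>)
      \<comment> \<open>The cycle condition for \<open>y\<close> at \<open>S - {c}\<close> isolates
        the term that adds \<open>c\<close>, namely \<open>y S U\<close>; the rest is the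
        differential inside \<open>A'\<close>.\<close>
      also have "restr_diff A y (S - {c}) U = 0"
        using y_cyc[OF s, of "S - {c}" U] S' S US U A by auto
      then have "- restr_diff A' y (S - {c}) U = y S U"
        using rd_nc[OF S'(1), of y U] S'(2) by (metis add.commute minus_unique)
      finally show ?thesis .
    qed

    define r where "r S U = y S U - restr_diff A x1 S U" for S U
    have r_coc: "cocycle (Suc k) S (r S)" if S: "S \<subseteq> A" "card S = s" for S
      unfolding r_def
    proof (rule cocycle_diff[OF y_coc[OF S] cocycle_restr_diff])
      fix j assume "j \<in> A - S"
      then show "cocycle (Suc k) (insert j S) (x1 (insert j S))"
        using x1_coc[of "insert j S"] S fin[OF S(1)] by auto
    qed
    have r_zero: "r S U = 0" if "S \<subseteq> A" "card S = s" "U \<subseteq> S" "card U = Suc k" "c \<notin> U" for S U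
      using x1_diff[OF that] by (simp add: r_def)
    have r_diff: "restr_diff A r S U = restr_diff A y S U" if "S \<subseteq> A" for S U
      using restr_diff_diff[of A y "restr_diff A x1" S U] restr_diff_restr_diff[OF Suc.prems(1) that, of x1 U]
      unfolding r_def by simp
    \<comment> \<open>The error \<open>r\<close> vanishes on faces avoiding \<open>c\<close>, so
      nothing is lost by removing \<open>c\<close> from both the simplex and the face. This lowers
      \<open>k\<close> and \<open>s\<close> by one each.\<close>
    define r' where "r' S T = r (insert c S) (insert c T)" for S T
    obtain s' where s': "s = Suc s'" using Suc.prems(2) by (cases s) auto
    have ins: "insert c S \<subseteq> A" "card (insert c S) = Suc (card S)" "c \<notin> S" if "S \<subseteq> A'" for S
      using that A finite_subset[OF that finA'] by (auto simp: card_insert_if)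
    have "\<exists>x'. (\<forall>S\<subseteq>A'. card S = Suc s' \<longrightarrow> cocycle k S (x' S)) \<and>
      (\<forall>S\<subseteq>A'. \<forall>U\<subseteq>S. card S = s' \<longrightarrow> card U = k \<longrightarrow> restr_diff A' x' S U = r' S U)"
    proof (rule Suc.IH[OF finA'])
      show "k \<le> s'" using Suc.prems(2) s' by simp
    next
      fix S assume S: "S \<subseteq> A'" "card S = s'"
      show "cocycle k S (r' S)"
        unfolding cocycle_def
      proof (intro allI impI)
        fix W assume W: "W \<subseteq> S" "card W = Suc k"
        then have WA: "W \<subseteq> A'" using S by auto
        have "cobd (r (insert c S)) (insert c W) = 0"
          by (rule cocycleD[OF r_coc[OF ins(1)[OF S(1)]]])
             (use ins(2)[OF S(1)] ins(2)[OF WA] W S s' in auto)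
        moreover have "r (insert c S) W = 0"
          using r_zero[OF ins(1)[OF S(1)]] ins(2)[OF S(1)] ins(3)[OF WA] W S s' by auto
        ultimately show "cobd (r' S) W = 0"
          using cobd_c[OF ins(1)[OF WA], of "r (insert c S)"] ins(3)[OF WA]
          by (simp add: r'_def[abs_def])
      qed
    next
      fix S U assume *: "k < s'" "S \<subseteq> A'" "Suc (card S) = s'" "U \<subseteq> S" "card U = k"
      have UA: "U \<subseteq> A'" using * by auto
      have "restr_diff A y (insert c S) (insert c U) = 0"
        using y_cyc[of "insert c S" "insert c U"] ins[OF *(2)] ins[OF UA] * s' by auto
      then show "restr_diff A' r' S U = 0"
        using r_diff[OF ins(1)[OF *(2)], of "insert c U"]
          rd_c[OF ins(1)[OF *(2)], of r "insert c U"] ins(3)[OF *(2)]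
        by (simp add: r'_def[abs_def] restr_diff_def)
    next
      assume sk: "s' = k"
      have "augment k A' r' = (\<Sum>S | S \<subseteq> A \<and> card S = Suc k \<and> c \<in> S. r S S)"
        unfolding augment_def r'_def
      proof (rule sum.reindex_bij_witness[of _ "\<lambda>S. S - {c}" "insert c"])
        fix S assume S: "S \<in> {S. S \<subseteq> A' \<and> card S = k}"
        then have "S \<subseteq> A'" by simp
        from ins[OF this] show "insert c S - {c} = S" "insert c S \<in> {S. S \<subseteq> A \<and> card S = Suc k \<and> c \<in> S}"
          using S by auto
      next
        fix S assume S: "S \<in> {S. S \<subseteq> A \<and> card S = Suc k \<and> c \<in> S}"
        then have "S \<subseteq> A" "c \<in> S" by simp_all
        from split[OF this] show "insert c (S - {c}) = S" "S - {c} \<in> {S. S \<subseteq> A' \<and> card S = k}"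
          using S by auto
      qed simp
      \<comment> \<open>If \<open>c\<close> is not in \<open>S\<close>, then \<open>S\<close> is
        itself a face avoiding \<open>c\<close>, so its term is 0.\<close>
      also have "\<dots> = augment (Suc k) A r"
        unfolding augment_def
        by (rule sum.mono_neutral_left) (use Suc.prems(1) r_zero s' sk in auto)
      also have "\<dots> = augment (Suc k) A y - augment (Suc k) A (restr_diff A x1)"
        by (simp add: augment_def r_def sum_subtractf)
      also have "\<dots> = 0"
        using y_aug augment_restr_diff[OF Suc.prems(1), of "Suc k" x1] x1_coc s' sk by auto
      finally show "augment k A' r' = 0" .
    qed
    then obtain x' where x'_coc: "\<forall>S\<subseteq>A'. card S = Suc s' \<longrightarrow> cocycle k S (x' S)"
      and x'_diff: "\<forall>S\<subseteq>A'. \<forall>U\<subseteq>S. card S = s' \<longrightarrow> card U = k \<longrightarrow> restr_diff A' x' S U = r' S U"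
      by (elim exE conjE that)
    define x2 where "x2 S U = (if c \<in> S \<and> c \<in> U then x' (S - {c}) (U - {c}) else 0)" for S U
    have x2_coc: "cocycle (Suc k) S (x2 S)" if S: "S \<subseteq> A" "card S = Suc s" for S
    proof (cases "c \<in> S")
      case False
      then show ?thesis by (intro cocycle_zero) (simp add: x2_def)
    next
      case True
      note S' = split[OF S(1) True]
      show ?thesis unfolding cocycle_def
      proof (intro allI impI)
        fix W assume W: "W \<subseteq> S" "card W = Suc (Suc k)"
        have WA: "W \<subseteq> A" using W S by auto
        show "cobd (x2 S) W = 0"
        proof (cases "c \<in> W")
          case cW: True
          note W' = split[OF WA cW]
          have "cobd (\<lambda>U. x2 S (insert c U)) (W - {c}) = cobd (x' (S - {c})) (W - {c})"
            by (rule cobd_cong) (use True in \<open>auto simp: x2_def insert_Diff_if\<close>)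
          also have "\<dots> = 0"
            by (rule cocycleD[OF x'_coc[rule_format, OF S'(1)]]) (use S'(3) W W'(3) S s' in auto)
          finally show ?thesis
            using cobd_c[OF WA cW, of "x2 S"] True by (simp add: x2_def)
        next
          case cW: False
          then show ?thesis unfolding cobd_def by (intro sum.neutral) (auto simp: x2_def)
        qed
      qed
    qed
    have x2_diff: "restr_diff A x2 S U = (if c \<in> U then - r S U else 0)"
      if S: "S \<subseteq> A" "card S = s" and U: "U \<subseteq> S" "card U = Suc k" for S U
    proof (cases "c \<in> U")
      case False
      then show ?thesis by (simp add: x2_def restr_diff_def)
    next
      case True
      then have cS: "c \<in> S" and UA: "U \<subseteq> A" using S U by auto
      note S' = split[OF S(1) cS] and U' = split[OF UA True]
      have "restr_diff A x2 S U = - restr_diff A' (\<lambda>T. x2 (insert c T)) (S - {c}) U"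
        by (rule rd_c[OF S(1) cS])
      also have "restr_diff A' (\<lambda>T. x2 (insert c T)) (S - {c}) U = restr_diff A' (\<lambda>T _. x' T (U - {c})) (S - {c}) U"
        by (rule restr_diff_cong) (use True A in \<open>auto simp: x2_def insert_Diff_if\<close>)
      also have "\<dots> = restr_diff A' x' (S - {c}) (U - {c})"
        by (simp add: restr_diff_def)
      also have "\<dots> = r' (S - {c}) (U - {c})"
        using S' U' S U s' by (intro x'_diff[rule_format]) auto
      finally show ?thesis using True S'(2) U'(2) by (simp add: r'_def)
    qed
    \<comment> \<open>Passing from \<open>A\<close> to \<open>A'\<close> on simplices through
      \<open>c\<close> costs a sign, so the differential of \<open>x2\<close> is \<open>- r\<close>
      on faces through \<open>c\<close>. The correction is therefore subtracted.\<close>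
    show ?thesis
    proof (intro exI[of _ "\<lambda>S U. x1 S U - x2 S U"] conjI allI impI)
      fix S assume "S \<subseteq> A" "card S = Suc s"
      then show "cocycle (Suc k) S (\<lambda>U. x1 S U - x2 S U)"
        by (intro cocycle_diff x1_coc x2_coc)
    next
      fix S U assume *: "S \<subseteq> A" "U \<subseteq> S" "card S = s" "card U = Suc k"
      show "restr_diff A (\<lambda>S U. x1 S U - x2 S U) S U = y S U"
        unfolding restr_diff_diff x2_diff[OF *(1,3,2,4)]
        using x1_diff[OF *(1,3,2,4)] by (simp add: r_def)
    qed
  qed
qed


section \<open>A basis of the cocycles\<close>

text \<open>For a basis index \<open>q = (S, U)\<close> this is the cocycle on \<open>S\<close> that
  is 1 on \<open>U\<close> and 0 on the other faces through \<open>Min S\<close>, extended by 0 to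
  all other simplices.\<close>

definition unit_chain :: "nat set \<times> nat set \<Rightarrow> nat set \<Rightarrow> nat set \<Rightarrow> 'a::comm_ring_1" where
  "unit_chain q S U = (if S = fst q then cone_ext S (\<lambda>T. if T = snd q then 1 else 0) U else 0)"

text \<open>The faces through the cone point are free coordinates for the cocycles on
  \<open>S\<close>. The condition \<open>Min S \<in> U\<close> with \<open>U \<subseteq> S\<close>
  also excludes the empty simplex.\<close>

definition strand_basis :: "nat \<Rightarrow> nat set \<Rightarrow> nat \<Rightarrow> (nat set \<times> nat set) set" where
  "strand_basis k A s = {(S, U). S \<subseteq> A \<and> U \<subseteq> S \<and> card S = s \<and> card U = k \<and> Min S \<in> U}"

lemma finite_strand_basis: "finite A \<Longrightarrow> finite (strand_basis k A s)"
  by (rule finite_subset[of _ "Pow A \<times> Pow A"]) (auto simp: strand_basis_def)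

lemma strand_basis_restrict:
  "A \<subseteq> N \<Longrightarrow> {q \<in> strand_basis k N s. fst q \<subseteq> A} = strand_basis k A s"
  by (auto simp: strand_basis_def)

lemma strand_basis_least:
  assumes "finite A" "1 \<le> k"
  shows "strand_basis k A k = (\<lambda>S. (S, S)) ` {S. S \<subseteq> A \<and> card S = k}"
proof
  show "strand_basis k A k \<subseteq> (\<lambda>S. (S, S)) ` {S. S \<subseteq> A \<and> card S = k}"
  proof
    fix q assume "q \<in> strand_basis k A k"
    then obtain S U where q: "q = (S, U)" "S \<subseteq> A" "U \<subseteq> S" "card S = k" "card U = k"
      by (auto simp: strand_basis_def)
    moreover have "U = S"
      using q assms(1) by (metis card_subset_eq finite_subset)
    ultimately show "q \<in> (\<lambda>S. (S, S)) ` {S. S \<subseteq> A \<and> card S = k}" by simp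
  qed
  show "(\<lambda>S. (S, S)) ` {S. S \<subseteq> A \<and> card S = k} \<subseteq> strand_basis k A k"
  proof
    fix q assume "q \<in> (\<lambda>S. (S, S)) ` {S. S \<subseteq> A \<and> card S = k}"
    then obtain S where S: "q = (S, S)" "S \<subseteq> A" "card S = k" by auto
    have "finite S" using S(2) assms(1) by (rule finite_subset)
    moreover have "S \<noteq> {}" using S(3) assms(2) by auto
    ultimately have "Min S \<in> S" by (rule Min_in)
    then show "q \<in> strand_basis k A k" using S by (simp add: strand_basis_def)
  qed
qed

lemma cocycle_unit_chain: "finite S \<Longrightarrow> cocycle k S (unit_chain q S)"
  by (cases "S = fst q") (auto simp: unit_chain_def[abs_def] cocycle_cone_ext cocycle_zero)

lemma unit_chain_least:
  "Min S \<in> U \<Longrightarrow> unit_chain q S U = (if q = (S, U) then 1 else 0)"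
  by (auto simp: unit_chain_def cone_ext_def prod_eq_iff)

text \<open>The cone formula expresses the value on a face avoiding \<open>Min S\<close> by values
  on faces through it.\<close>

lemma cocycle_eqI:
  assumes "finite S" "S \<noteq> {}" "cocycle k S y" "cocycle k S z" "U \<subseteq> S" "card U = k"
    and eq: "\<And>T. T \<subseteq> S \<Longrightarrow> card T = k \<Longrightarrow> Min S \<in> T \<Longrightarrow> y T = z T"
  shows "y U = z U"
proof (cases "Min S \<in> U")
  case True
  then show ?thesis using assms(5,6) eq by blast
next
  case False
  have finU: "finite U" using assms(1,5) finite_subset by blast
  have "y U = cobd (\<lambda>T. y (insert (Min S) T)) U"
    by (rule cocycle_cone) (use assms(1-6) False in auto)
  also have "\<dots> = cobd (\<lambda>T. z (insert (Min S) T)) U"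
  proof (rule cobd_cong, rule eq)
    fix w assume w: "w \<in> U"
    show "insert (Min S) (U - {w}) \<subseteq> S"
      using assms(5) Min_in[OF assms(1,2)] by blast
    have "card (insert (Min S) (U - {w})) = Suc (card (U - {w}))"
      using False finU by (intro card_insert_disjoint) auto
    then show "card (insert (Min S) (U - {w})) = k"
      using card.remove[OF finU w] assms(6) by simp
  qed simp
  also have "\<dots> = z U"
    by (rule cocycle_cone[symmetric]) (use assms(1-6) False in auto)
  finally show ?thesis .
qed

lemma cocycle_sum:
  "(\<And>q. q \<in> Q \<Longrightarrow> cocycle k S (f q)) \<Longrightarrow> cocycle k S (\<lambda>U. \<Sum>q\<in>Q. f q U * t q)"
  by (simp add: cocycle_def cobd_sum)

lemma sum_unit_chain_least:
  fixes t :: "nat set \<times> nat set \<Rightarrow> 'a::comm_ring_1"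
  assumes "finite A" "(S, U) \<in> strand_basis k A s"
  shows "(\<Sum>q\<in>strand_basis k A s. unit_chain q S U * t q) = t (S, U)"
proof -
  have "Min S \<in> U" using assms(2) by (simp add: strand_basis_def)
  then have "(\<Sum>q\<in>strand_basis k A s. unit_chain q S U * t q)
      = (\<Sum>q\<in>strand_basis k A s. if q = (S, U) then t q else 0)"
    by (intro sum.cong) (auto simp: unit_chain_least)
  then show ?thesis
    using assms finite_strand_basis by (simp add: sum.delta)
qed

text \<open>Both sides are cocycles on \<open>S\<close> with the same values on the faces through
  \<open>Min S\<close>, so the coordinates of a cocycle are simply some of its values.\<close>

lemma cocycle_expand:
  assumes "finite A" "S \<subseteq> A" "S \<noteq> {}" "card S = s" "cocycle k S (z S)" "U \<subseteq> S" "card U = k"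
  shows "(\<Sum>q\<in>strand_basis k A s. unit_chain q S U * z (fst q) (snd q)) = z S U"
proof -
  have fin: "finite S" using assms finite_subset by blast
  show ?thesis
  proof (rule cocycle_eqI[OF fin assms(3) _ assms(5-7), of "\<lambda>U. \<Sum>q\<in>strand_basis k A s. unit_chain q S U * z (fst q) (snd q)"])
    show "cocycle k S (\<lambda>U. \<Sum>q\<in>strand_basis k A s. unit_chain q S U * z (fst q) (snd q))"
      by (intro cocycle_sum cocycle_unit_chain fin)
  next
    fix T assume "T \<subseteq> S" "card T = k" "Min S \<in> T"
    then have "(S, T) \<in> strand_basis k A s" using assms by (simp add: strand_basis_def)
    then show "(\<Sum>q\<in>strand_basis k A s. unit_chain q S T * z (fst q) (snd q)) = z S T"
      using sum_unit_chain_least[OF assms(1), of S T k s "\<lambda>q. z (fst q) (snd q)"] by simp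
  qed
qed

section \<open>Matrix coefficients of the differential\<close>

lemma restr_diff_sum:
  "restr_diff A (\<lambda>S U. \<Sum>q\<in>Q. f q S U * t q) S U = (\<Sum>q\<in>Q. restr_diff A (f q) S U * t q)"
  unfolding restr_diff_def sum_distrib_left sum_distrib_right mult.assoc by (rule sum.swap)

text \<open>A nonzero coefficient requires \<open>insert j S = fst q\<close> for some new vertex
  \<open>j\<close>. The strict inclusion later gives both divisibility of multidegrees and
  minimality of the resolution.\<close>

lemma restr_diff_unit_chain_support:
  "restr_diff A (unit_chain q) S U \<noteq> 0 \<Longrightarrow> S \<subset> fst q"
proof (rule ccontr)
  assume nz: "restr_diff A (unit_chain q) S U \<noteq> 0" and "\<not> S \<subset> fst q"
  then have "insert j S \<noteq> fst q" if "j \<in> A - S" for j using that by auto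
  then show False using nz by (simp add: restr_diff_def unit_chain_def)
qed

text \<open>Only vertices of \<open>fst q\<close> contribute, so the coefficients formed once for
  all edges \<open>N\<close> serve in the strand of every \<open>A\<close>.\<close>

lemma restr_diff_unit_chain_mono:
  assumes "A \<subseteq> N" "finite N" "fst q \<subseteq> A"
  shows "restr_diff N (unit_chain q) S U = restr_diff A (unit_chain q) S U"
  unfolding restr_diff_def
  by (rule sum.mono_neutral_right) (use assms in \<open>auto simp: unit_chain_def\<close>)

lemma restr_diff_expand:
  fixes z :: "nat set \<Rightarrow> nat set \<Rightarrow> 'a::comm_ring_1"
  assumes "finite A" "S \<subseteq> A" "card S = s" "U \<subseteq> S" "card U = k"
    and "\<And>T. T \<subseteq> A \<Longrightarrow> card T = Suc s \<Longrightarrow> cocycle k T (z T)"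
  shows "(\<Sum>q\<in>strand_basis k A (Suc s). restr_diff A (unit_chain q) S U * z (fst q) (snd q)) = restr_diff A z S U"
  unfolding restr_diff_sum[symmetric]
proof (rule restr_diff_cong)
  fix j assume j: "j \<in> A - S"
  have "finite S" using assms finite_subset by blast
  then show "(\<Sum>q\<in>strand_basis k A (Suc s). unit_chain q (insert j S) U * z (fst q) (snd q)) = z (insert j S) U"
    using j assms by (intro cocycle_expand) auto
qed

text \<open>Level \<open>0\<close> is the target of the augmentation; its single basis element carries the empty
  multidegree.\<close>

definition level_basis :: "nat \<Rightarrow> nat set \<Rightarrow> nat \<Rightarrow> (nat set \<times> nat set) set" where
  "level_basis k A i = (case i of 0 \<Rightarrow> {({}, {})} | Suc i \<Rightarrow> strand_basis k A (k + i))"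

text \<open>The coordinate at \<open>p\<close> of a cocycle is its value on the face
  \<open>snd p\<close> of \<open>fst p\<close>, so the matrix of the differential is read off by
  evaluation. At level 0 the augmentation has all entries 1.\<close>

definition level_coeff :: "nat set \<Rightarrow> nat \<Rightarrow> nat set \<times> nat set \<Rightarrow> nat set \<times> nat set \<Rightarrow> 'a::comm_ring_1" where
  "level_coeff N i p q = (case i of 0 \<Rightarrow> 1 | Suc i \<Rightarrow> restr_diff N (unit_chain q) (fst p) (snd p))"

lemma sum_strand_basis_augment:
  assumes "finite A" "1 \<le> k"
  shows "(\<Sum>q\<in>strand_basis k A k. z (fst q) (snd q)) = augment k A z"
  unfolding strand_basis_least[OF assms] augment_def
  by (subst sum.reindex) (auto simp: inj_on_def)

text \<open>Summation over \<open>q\<close> expands the cocycles of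
  \<open>restr_diff N (unit_chain r)\<close> in the basis, so the matrix product computes a double
  differential or, at level 0, the augmentation of a differential.\<close>

lemma level_complex:
  assumes N: "finite N" and k: "1 \<le> k" and p: "p \<in> level_basis k N i"
  shows "(\<Sum>q\<in>level_basis k N (Suc i). level_coeff N i p q * level_coeff N (Suc i) q r) = (0::'a::comm_ring_1)"
proof -
  let ?Y = "restr_diff N (unit_chain r) :: nat set \<Rightarrow> nat set \<Rightarrow> 'a"
  have fin: "finite S" if "S \<subseteq> N" for S using that N finite_subset by blast
  have coc: "cocycle k S (?Y S)" if "S \<subseteq> N" for S
    using fin that by (intro cocycle_restr_diff cocycle_unit_chain) auto
  show ?thesis
  proof (cases i)
    case 0
    then show ?thesis
      using sum_strand_basis_augment[OF N k, of ?Y] augment_restr_diff[OF N, of k "unit_chain r :: _ \<Rightarrow> _ \<Rightarrow> 'a"] fin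
      by (simp add: level_basis_def level_coeff_def cocycle_unit_chain)
  next
    case (Suc i')
    obtain S U where SU: "p = (S, U)" by (cases p)
    have *: "S \<subseteq> N" "card S = k + i'" "U \<subseteq> S" "card U = k"
      using p by (auto simp: SU Suc level_basis_def strand_basis_def)
    show ?thesis
      using restr_diff_expand[OF N *(1-4), of ?Y] coc restr_diff_restr_diff[OF N *(1)]
      by (simp add: level_basis_def level_coeff_def Suc SU)
  qed
qed

text \<open>The coefficients refer to all edges \<open>N\<close>, the sums only to \<open>A\<close>:
  this is the form that arises in a multidegree divisible exactly by the edges of
  \<open>A\<close>.\<close>

lemma level_exact:
  fixes t :: "nat set \<times> nat set \<Rightarrow> 'a::comm_ring_1"
  assumes N: "finite N" and k: "1 \<le> k" and AN: "A \<subseteq> N"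
    and t: "\<And>p. p \<in> level_basis k A i \<Longrightarrow> (\<Sum>q\<in>level_basis k A (Suc i). level_coeff N i p q * t q) = 0"
  shows "\<exists>x. \<forall>q\<in>level_basis k A (Suc i). t q = (\<Sum>r\<in>level_basis k A (Suc (Suc i)). level_coeff N (Suc i) q r * x r)"
proof -
  have A: "finite A" using N AN finite_subset by blast
  have fin: "finite S" if "S \<subseteq> A" for S using that A finite_subset by blast
  have mono: "restr_diff N (unit_chain q) S U = (restr_diff A (unit_chain q) S U :: 'a)"
    if "q \<in> strand_basis k A s" for q s S U
    using that AN N by (intro restr_diff_unit_chain_mono) (auto simp: strand_basis_def)
  \<comment> \<open>The family of cocycles with coordinates \<open>t\<close>.\<close>
  define y where "y S U = (\<Sum>q\<in>strand_basis k A (k + i). unit_chain q S U * t q)" for S U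
  have y_coc: "cocycle k S (y S)" if "S \<subseteq> A" for S
    unfolding y_def using fin[OF that] by (intro cocycle_sum cocycle_unit_chain)
  have y_least: "y S U = t (S, U)" if "(S, U) \<in> strand_basis k A (k + i)" for S U
    unfolding y_def by (rule sum_unit_chain_least[OF A that])
  have "\<exists>x. (\<forall>S\<subseteq>A. card S = Suc (k + i) \<longrightarrow> cocycle k S (x S)) \<and>
    (\<forall>S\<subseteq>A. \<forall>U\<subseteq>S. card S = k + i \<longrightarrow> card U = k \<longrightarrow> restr_diff A x S U = y S U)"
  proof (rule strand_exact[OF A])
    fix S U assume *: "k < k + i" "S \<subseteq> A" "Suc (card S) = k + i" "U \<subseteq> S" "card U = k"
    then obtain i' where i': "i = Suc i'" by (cases i) auto
    have ne: "S \<noteq> {}" using * k i' by auto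
    \<comment> \<open>The hypothesis gives the cycle condition only at basis faces; both sides being
      cocycles, it extends to all faces.\<close>
    have "restr_diff A y S U = (\<lambda>_. 0) U"
    proof (rule cocycle_eqI[OF fin[OF *(2)] ne _ _ *(4,5)])
      show "cocycle k S (restr_diff A y S)"
        using * by (intro cocycle_restr_diff y_coc) auto
      show "cocycle k S (\<lambda>_. 0 :: 'a)" by (simp add: cocycle_zero)
    next
      fix T assume "T \<subseteq> S" "card T = k" "Min S \<in> T"
      then have "(S, T) \<in> level_basis k A i"
        using * i' by (simp add: level_basis_def strand_basis_def)
      from t[OF this] show "restr_diff A y S T = 0"
        unfolding y_def restr_diff_sum by (simp add: level_basis_def level_coeff_def i' mono)
    qed
    then show "restr_diff A y S U = 0" .
  next
    assume i: "k + i = k"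
    have "augment k A y = (\<Sum>q\<in>strand_basis k A k. y (fst q) (snd q))"
      by (rule sum_strand_basis_augment[OF A k, symmetric])
    also have "\<dots> = (\<Sum>q\<in>strand_basis k A k. t q)"
      using i by (intro sum.cong) (auto simp: y_least)
    also have "\<dots> = 0"
      using t[of "({}, {})"] i by (simp add: level_basis_def level_coeff_def)
    finally show "augment k A y = 0" .
  qed (use y_coc in auto)
  then obtain x where x_coc: "\<forall>S\<subseteq>A. card S = Suc (k + i) \<longrightarrow> cocycle k S (x S)"
    and x_diff: "\<forall>S\<subseteq>A. \<forall>U\<subseteq>S. card S = k + i \<longrightarrow> card U = k \<longrightarrow> restr_diff A x S U = y S U"
    by (elim exE conjE that)
  show ?thesis
  proof (intro exI[of _ "\<lambda>r. x (fst r) (snd r)"] ballI)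
    fix q assume q: "q \<in> level_basis k A (Suc i)"
    obtain S U where SU: "q = (S, U)" by (cases q)
    have *: "S \<subseteq> A" "card S = k + i" "U \<subseteq> S" "card U = k" "(S, U) \<in> strand_basis k A (k + i)"
      using q by (auto simp: SU level_basis_def strand_basis_def)
    have "t q = restr_diff A x S U"
      using x_diff[rule_format, OF *(1,3,2,4)] y_least[OF *(5)] SU by simp
    then show "t q = (\<Sum>r\<in>level_basis k A (Suc (Suc i)). level_coeff N (Suc i) q r * x (fst r) (snd r))"
      using restr_diff_expand[OF A *(1-4), of x] x_coc
      by (simp add: level_basis_def level_coeff_def SU mono)
  qed
qed


section \<open>Multigraded complexes with scalar coefficients\<close>

definition mono_dvd :: "('v \<Rightarrow>\<^sub>0 nat) \<Rightarrow> ('v \<Rightarrow>\<^sub>0 nat) \<Rightarrow> bool" where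
  "mono_dvd a m \<longleftrightarrow> (\<exists>r. m = a + r)"

lemma mono_dvd_diff: "mono_dvd a m \<Longrightarrow> a + (m - a) = m"
  by (auto simp: mono_dvd_def)

lemma mono_dvd_add: "mono_dvd a (a + r)"
  by (auto simp: mono_dvd_def)

lemma mono_dvd_trans: "mono_dvd a b \<Longrightarrow> mono_dvd b m \<Longrightarrow> mono_dvd a m"
  by (auto simp: mono_dvd_def add.assoc)

lemma mono_dvd_iff_lookup: "mono_dvd a m \<longleftrightarrow> (\<forall>v. Poly_Mapping.lookup a v \<le> Poly_Mapping.lookup m v)"
proof
  assume "\<forall>v. Poly_Mapping.lookup a v \<le> Poly_Mapping.lookup m v"
  then have "m = a + (m - a)"
    by (intro poly_mapping_eqI) (simp add: lookup_add lookup_minus)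
  then show "mono_dvd a m" unfolding mono_dvd_def by blast
qed (auto simp: mono_dvd_def lookup_add)

lemma keys_add_nat:
  "Poly_Mapping.keys (a + b) = Poly_Mapping.keys a \<union> Poly_Mapping.keys (b :: 'v \<Rightarrow>\<^sub>0 nat)"
  by (auto simp: in_keys_iff lookup_add)

lemma lookup_single_mult:
  fixes p :: "('v \<Rightarrow>\<^sub>0 nat) \<Rightarrow>\<^sub>0 'k::comm_semiring_1"
  shows "Poly_Mapping.lookup (Poly_Mapping.single a x * p) m
    = (if mono_dvd a m then x * Poly_Mapping.lookup p (m - a) else 0)"
proof -
  have *: "(x when a = l) * y = (x * y when a = l)" for l and y :: 'k
    by (simp add: when_def)
  have "Poly_Mapping.lookup (Poly_Mapping.single a x * p) m
      = x * (\<Sum>q. Poly_Mapping.lookup p q when m = a + q)"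
    unfolding lookup_mult lookup_single * by simp
  also have "(\<Sum>q. Poly_Mapping.lookup p q when m = a + q)
      = (if mono_dvd a m then Poly_Mapping.lookup p (m - a) else 0)"
  proof (cases "mono_dvd a m")
    case True
    then have "m = a + q \<longleftrightarrow> m - a = q" for q by (auto simp: mono_dvd_def)
    then show ?thesis using True by simp
  next
    case False
    then have "m \<noteq> a + q" for q by (auto simp: mono_dvd_def)
    then show ?thesis using False by simp
  qed
  finally show ?thesis by simp
qed

lemma monom_deg_superset:
  "finite A \<Longrightarrow> Poly_Mapping.keys m \<subseteq> A \<Longrightarrow> monom_deg m = (\<Sum>v\<in>A. Poly_Mapping.lookup m v)"
  unfolding monom_deg_def by (rule sum.mono_neutral_left) (auto simp: in_keys_iff)

lemma monom_deg_add: "monom_deg (a + b) = monom_deg a + monom_deg b"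
proof -
  let ?A = "Poly_Mapping.keys a \<union> Poly_Mapping.keys b"
  have "monom_deg (a + b) = (\<Sum>v\<in>?A. Poly_Mapping.lookup (a + b) v)"
    by (rule monom_deg_superset) (auto simp: keys_add_nat)
  also have "\<dots> = monom_deg a + monom_deg b"
    using monom_deg_superset[of ?A a] monom_deg_superset[of ?A b] by (simp add: lookup_add sum.distrib)
  finally show ?thesis .
qed

lemma sum_mpoly_ring_closed:
  "(\<And>x. x \<in> X \<Longrightarrow> f x \<in> carrier (mpoly_ring V)) \<Longrightarrow> sum f X \<in> carrier (mpoly_ring V)"
  by (induction X rule: infinite_finite_induct) (auto simp: mpoly_ring_closed)

lemma vec_as_family:
  assumes "distinct xs" "w \<in> carrier_vec (length xs)"
  shows "\<exists>u. w = vec (length xs) (\<lambda>l. u (xs ! l)) \<and> (\<forall>b\<in>set xs. u b \<in> set\<^sub>v w)"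
proof (intro exI conjI ballI)
  let ?u = "\<lambda>b. w $ (the_inv_into {..<length xs} (nth xs) b)"
  have "inj_on (nth xs) {..<length xs}" using assms(1) by (auto simp: inj_on_def nth_eq_iff_index_eq)
  then have inv: "the_inv_into {..<length xs} (nth xs) (xs ! l) = l" if "l < length xs" for l
    using that by (auto intro: the_inv_into_f_f)
  then show "w = vec (length xs) (\<lambda>l. ?u (xs ! l))" using assms by (intro eq_vecI) auto
  fix b assume "b \<in> set xs"
  then obtain l where "l < length xs" "b = xs ! l" by (auto simp: in_set_conv_nth)
  then show "?u b \<in> set\<^sub>v w" using inv assms by (auto intro!: vec_setI)
qed

lemma sum_nth_distinct:
  "distinct xs \<Longrightarrow> (\<Sum>l = 0..<length xs. f (xs ! l)) = sum f (set xs)"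
  by (rule sum.reindex_bij_betw) (auto intro: bij_betw_nth simp: atLeast0LessThan)

text \<open>A multigraded free complex over \<open>R\<close> whose maps are given by scalars: \<open>c i p q\<close> is the
  coefficient of the map from the basis element \<open>q\<close> of \<open>F\<^bsub>i+1\<^esub>\<close> to \<open>p\<close> of \<open>F\<^bsub>i\<^esub>\<close>, where \<open>F\<^bsub>0\<^esub> = R\<close>. It is
  exact as soon as each multigraded strand, a complex of vector spaces, is exact.\<close>

locale scalar_complex =
  fixes V :: "'v set" and B :: "nat \<Rightarrow> 'b list" and g :: "'b \<Rightarrow> ('v \<Rightarrow>\<^sub>0 nat)"
    and c :: "nat \<Rightarrow> 'b \<Rightarrow> 'b \<Rightarrow> 'k::field"
  assumes distinct_basis: "distinct (B i)"
    and mdeg_vars: "b \<in> set (B i) \<Longrightarrow> Poly_Mapping.keys (g b) \<subseteq> V"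
    and level_zero: "map g (B 0) = [0]"
    and coeff_dvd: "p \<in> set (B i) \<Longrightarrow> q \<in> set (B (Suc i)) \<Longrightarrow> c i p q \<noteq> 0 \<Longrightarrow> mono_dvd (g p) (g q)"
    and coeff_minimal: "p \<in> set (B (Suc i)) \<Longrightarrow> q \<in> set (B (Suc (Suc i))) \<Longrightarrow> c (Suc i) p q \<noteq> 0 \<Longrightarrow> g p \<noteq> g q"
    and scalar_complex: "p \<in> set (B i) \<Longrightarrow> r \<in> set (B (Suc (Suc i))) \<Longrightarrow>
      (\<Sum>q\<in>set (B (Suc i)). c i p q * c (Suc i) q r) = 0"
    and scalar_exact: "(\<And>p. p \<in> set (B i) \<Longrightarrow> mono_dvd (g p) m \<Longrightarrow>
        (\<Sum>q | q \<in> set (B (Suc i)) \<and> mono_dvd (g q) m. c i p q * t q) = 0) \<Longrightarrow>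
      \<exists>x. \<forall>q. q \<in> set (B (Suc i)) \<longrightarrow> mono_dvd (g q) m \<longrightarrow>
        t q = (\<Sum>r | r \<in> set (B (Suc (Suc i))) \<and> mono_dvd (g r) m. c (Suc i) q r * x r)"
    and scalar_surj: "q \<in> set (B (Suc 0)) \<Longrightarrow> p \<in> set (B 0) \<Longrightarrow> c 0 p q \<noteq> 0"
begin

text \<open>Subtraction of exponents is truncated, but wherever \<open>g p\<close> does not divide
  \<open>g q\<close> the scalar is 0 by \<open>coeff_dvd\<close>.\<close>

definition diff_entry :: "nat \<Rightarrow> 'b \<Rightarrow> 'b \<Rightarrow> ('v, 'k) mpoly" where
  "diff_entry i p q = Poly_Mapping.single (g q - g p) (c i p q)"

definition diff_mat :: "nat \<Rightarrow> ('v, 'k) mpoly mat" where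
  "diff_mat i = mat (length (B i)) (length (B (Suc i))) (\<lambda>(p, q). diff_entry i (B i ! p) (B (Suc i) ! q))"

definition degs :: "nat \<Rightarrow> int list" where
  "degs i = map (\<lambda>b. int (monom_deg (g b))) (B i)"

definition diff_act :: "nat \<Rightarrow> ('b \<Rightarrow> ('v, 'k) mpoly) \<Rightarrow> 'b \<Rightarrow> ('v, 'k) mpoly" where
  "diff_act i u p = (\<Sum>q\<in>set (B (Suc i)). diff_entry i p q * u q)"

text \<open>In multidegree \<open>m\<close> a free module has one coordinate for each basis element
  \<open>b\<close> whose degree divides \<open>m\<close>, namely the coefficient of the monomial
  \<open>m - g b\<close>.\<close>

definition strand :: "('v \<Rightarrow>\<^sub>0 nat) \<Rightarrow> ('b \<Rightarrow> ('v, 'k) mpoly) \<Rightarrow> 'b \<Rightarrow> 'k" where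
  "strand m u b = (if mono_dvd (g b) m then Poly_Mapping.lookup (u b) (m - g b) else 0)"

lemma lookup_strand: "Poly_Mapping.lookup (u b) r = strand (g b + r) u b"
  by (simp add: strand_def mono_dvd_add)

lemma diff_mat_mult:
  "diff_mat i *\<^sub>v vec (length (B (Suc i))) (\<lambda>l. u (B (Suc i) ! l)) = vec (length (B i)) (\<lambda>l. diff_act i u (B i ! l))"
proof (rule eq_vecI)
  fix l assume "l < dim_vec (vec (length (B i)) (\<lambda>l. diff_act i u (B i ! l)))"
  then have l: "l < length (B i)" by simp
  then have "(diff_mat i *\<^sub>v vec (length (B (Suc i))) (\<lambda>l. u (B (Suc i) ! l))) $ l
      = (\<Sum>j = 0..<length (B (Suc i)). diff_entry i (B i ! l) (B (Suc i) ! j) * u (B (Suc i) ! j))"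
    by (simp add: diff_mat_def scalar_prod_def)
  also have "\<dots> = diff_act i u (B i ! l)"
    unfolding diff_act_def by (rule sum_nth_distinct[OF distinct_basis])
  finally show "(diff_mat i *\<^sub>v vec (length (B (Suc i))) (\<lambda>l. u (B (Suc i) ! l))) $ l
      = vec (length (B i)) (\<lambda>l. diff_act i u (B i ! l)) $ l" using l by simp
qed (simp add: diff_mat_def)

text \<open>An entry is a scalar times the monomial that fills the gap between two degrees, so
  within one multidegree only the scalar remains.\<close>

lemma strand_diff_act:
  assumes p: "p \<in> set (B i)" "mono_dvd (g p) m"
  shows "strand m (diff_act i u) p = (\<Sum>q | q \<in> set (B (Suc i)) \<and> mono_dvd (g q) m. c i p q * strand m u q)"
proof -
  have "Poly_Mapping.lookup (diff_entry i p q * u q) (m - g p)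
      = (if mono_dvd (g q) m then c i p q * strand m u q else 0)"
    if q: "q \<in> set (B (Suc i))" for q
  proof (cases "c i p q = 0")
    case True
    then show ?thesis by (simp add: diff_entry_def)
  next
    case False
    then obtain r where r: "g q = g p + r" using coeff_dvd[OF p(1) q] by (auto simp: mono_dvd_def)
    obtain s where s: "m = g p + s" using p(2) by (auto simp: mono_dvd_def)
    have "mono_dvd r s \<longleftrightarrow> mono_dvd (g q) m"
      by (auto simp: mono_dvd_def r s add.assoc)
    then show ?thesis
      by (auto simp: diff_entry_def lookup_single_mult strand_def r s mono_dvd_def add.assoc)
  qed
  then have "strand m (diff_act i u) p = (\<Sum>q\<in>set (B (Suc i)). if mono_dvd (g q) m then c i p q * strand m u q else 0)"
    using p(2) by (simp add: strand_def diff_act_def lookup_sum)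
  also have "\<dots> = (\<Sum>q | q \<in> set (B (Suc i)) \<and> mono_dvd (g q) m. c i p q * strand m u q)"
    by (rule sum.inter_filter[symmetric]) simp
  finally show ?thesis .
qed

lemma diff_entry_carrier:
  assumes "p \<in> set (B i)" "q \<in> set (B (Suc i))"
  shows "diff_entry i p q \<in> carrier (mpoly_ring V)"
proof (cases "c i p q = 0")
  case True
  then show ?thesis by (simp add: diff_entry_def mpoly_ring_simps)
next
  case False
  then obtain r where r: "g q = g p + r" using coeff_dvd[OF assms] by (auto simp: mono_dvd_def)
  then show ?thesis
    using mdeg_vars[OF assms(2)] by (auto simp: diff_entry_def mpoly_ring_simps keys_add_nat)
qed

text \<open>Solutions chosen separately in each multidegree are glued to polynomials: the
  coefficient of \<open>u q\<close> at \<open>r\<close> comes from the solution in degree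
  \<open>g q + r\<close>.\<close>

lemma diff_act_preimage:
  assumes t: "\<And>p. p \<in> set (B i) \<Longrightarrow> t p \<in> carrier (mpoly_ring V)"
    and ex: "\<And>m. \<exists>x. \<forall>p. p \<in> set (B i) \<longrightarrow> mono_dvd (g p) m \<longrightarrow>
      strand m t p = (\<Sum>q | q \<in> set (B (Suc i)) \<and> mono_dvd (g q) m. c i p q * x q)"
  shows "\<exists>u. (\<forall>b. u b \<in> carrier (mpoly_ring V)) \<and> (\<forall>p\<in>set (B i). diff_act i u p = t p)"
proof -
  obtain X where X: "\<And>m p. p \<in> set (B i) \<Longrightarrow> mono_dvd (g p) m \<Longrightarrow>
      strand m t p = (\<Sum>q | q \<in> set (B (Suc i)) \<and> mono_dvd (g q) m. c i p q * X m q)"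
    using ex by metis
  \<comment> \<open>The finitely many multidegrees occurring in \<open>t\<close>. Solutions in other
    degrees are replaced by 0, which makes \<open>u\<close> finitely supported and keeps its
    variables in \<open>V\<close>.\<close>
  define F where "F = (\<Union>p\<in>set (B i). (\<lambda>r. g p + r) ` Poly_Mapping.keys (t p))"
  have finF: "finite F" by (simp add: F_def)
  have F_vars: "Poly_Mapping.keys m \<subseteq> V" if "m \<in> F" for m
    using that t mdeg_vars by (fastforce simp: F_def keys_add_nat mpoly_ring_simps)
  have F: "m \<in> F" if "p \<in> set (B i)" "strand m t p \<noteq> 0" for m p
  proof -
    have "mono_dvd (g p) m" "m - g p \<in> Poly_Mapping.keys (t p)"
      using that by (auto simp: strand_def in_keys_iff split: if_splits)
    then have "m \<in> (\<lambda>r. g p + r) ` Poly_Mapping.keys (t p)"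
      by (metis image_eqI mono_dvd_diff)
    then show ?thesis using that by (auto simp: F_def)
  qed
  define u where "u q = Abs_poly_mapping (\<lambda>r. if g q + r \<in> F then X (g q + r) q else 0)" for q
  have look: "Poly_Mapping.lookup (u q) r = (if g q + r \<in> F then X (g q + r) q else 0)" for q r
  proof -
    have "finite ((\<lambda>r. g q + r) -` F)" by (rule finite_vimageI[OF finF]) (simp add: inj_on_def)
    then have "finite {r. (if g q + r \<in> F then X (g q + r) q else 0) \<noteq> 0}"
      by (rule rev_finite_subset) auto
    then show ?thesis by (simp add: u_def)
  qed
  have "u q \<in> carrier (mpoly_ring V)" for q
    unfolding mpoly_ring_simps
  proof
    fix r assume "r \<in> Poly_Mapping.keys (u q)"
    then have "g q + r \<in> F" by (auto simp: in_keys_iff look split: if_splits)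
    then show "Poly_Mapping.keys r \<subseteq> V" using F_vars[of "g q + r"] by (simp add: keys_add_nat)
  qed
  moreover have "diff_act i u p = t p" if p: "p \<in> set (B i)" for p
  proof (rule poly_mapping_eqI)
    fix r
    let ?m = "g p + r"
    have "strand ?m u q = (if ?m \<in> F then X ?m q else 0)" if "mono_dvd (g q) ?m" for q
      using that mono_dvd_diff[OF that] by (simp add: strand_def look)
    then have "strand ?m (diff_act i u) p = (\<Sum>q | q \<in> set (B (Suc i)) \<and> mono_dvd (g q) ?m. c i p q * (if ?m \<in> F then X ?m q else 0))"
      unfolding strand_diff_act[OF p mono_dvd_add] by (intro sum.cong) auto
    also have "\<dots> = strand ?m t p"
      using X[OF p mono_dvd_add[of "g p" r]] F[OF p, of ?m] by (cases "?m \<in> F") auto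
    finally show "Poly_Mapping.lookup (diff_act i u p) r = Poly_Mapping.lookup (t p) r"
      by (simp add: lookup_strand)
  qed
  ultimately show ?thesis by blast
qed

lemma graded_hom_diff_mat: "graded_hom V (degs (Suc i)) (degs i) (diff_mat i)"
  unfolding graded_hom_def
proof (intro conjI allI impI)
  show "diff_mat i \<in> carrier_mat (length (degs i)) (length (degs (Suc i)))"
    by (simp add: diff_mat_def degs_def)
  show "elements_mat (diff_mat i) \<subseteq> carrier (mpoly_ring V)"
    by (auto simp: elements_mat_def diff_mat_def intro!: diff_entry_carrier)
  fix p q assume pq: "p < length (degs i)" "q < length (degs (Suc i))"
  let ?p = "B i ! p" and ?q = "B (Suc i) ! q"
  have "homogeneous (int (monom_deg (g ?q)) - int (monom_deg (g ?p))) (diff_entry i ?p ?q)"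
  proof (cases "c i ?p ?q = 0")
    case True
    then show ?thesis by (simp add: diff_entry_def homogeneous_def)
  next
    case False
    then obtain r where r: "g ?q = g ?p + r"
      using coeff_dvd[of ?p i ?q] pq by (auto simp: mono_dvd_def degs_def)
    then show ?thesis by (simp add: diff_entry_def homogeneous_def monom_deg_add)
  qed
  then show "homogeneous (degs (Suc i) ! q - degs i ! p) (diff_mat i $$ (p, q))"
    using pq by (simp add: degs_def diff_mat_def)
qed

lemma free_mod_family:
  assumes "w \<in> free_mod V (length (degs i))"
  obtains u where "w = vec (length (B i)) (\<lambda>l. u (B i ! l))" "\<And>b. b \<in> set (B i) \<Longrightarrow> u b \<in> carrier (mpoly_ring V)"
proof -
  have w: "w \<in> carrier_vec (length (B i))" "set\<^sub>v w \<subseteq> carrier (mpoly_ring V)"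
    using assms by (auto simp: free_mod_def degs_def)
  obtain u where u: "w = vec (length (B i)) (\<lambda>l. u (B i ! l))" "\<forall>b\<in>set (B i). u b \<in> set\<^sub>v w"
    using vec_as_family[OF distinct_basis w(1)] by (elim exE conjE)
  show thesis by (rule that[OF u(1)]) (use u(2) w(2) in blast)
qed

lemma family_free_mod:
  "(\<And>b. b \<in> set (B i) \<Longrightarrow> u b \<in> carrier (mpoly_ring V)) \<Longrightarrow> vec (length (B i)) (\<lambda>l. u (B i ! l)) \<in> free_mod V (length (degs i))"
  by (auto simp: free_mod_def degs_def vec_set_def)

lemma diff_act_carrier:
  "p \<in> set (B i) \<Longrightarrow> (\<And>b. b \<in> set (B (Suc i)) \<Longrightarrow> u b \<in> carrier (mpoly_ring V)) \<Longrightarrow>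
    diff_act i u p \<in> carrier (mpoly_ring V)"
  unfolding diff_act_def by (intro sum_mpoly_ring_closed mpoly_ring_closed diff_entry_carrier)

text \<open>In degree \<open>m\<close> the middle sum runs only over \<open>q\<close> with
  \<open>g q\<close> dividing \<open>m\<close>. This omits nothing, since a nonzero
  \<open>c (Suc i) q r\<close> makes \<open>g q\<close> divide \<open>g r\<close>, which divides
  \<open>m\<close>.\<close>

lemma diff_act_diff_act:
  assumes p: "p \<in> set (B i)"
  shows "diff_act i (diff_act (Suc i) u) p = 0"
proof (rule poly_mapping_eqI)
  fix s
  let ?m = "g p + s"
  let ?Q = "{q. q \<in> set (B (Suc i)) \<and> mono_dvd (g q) ?m}"
  let ?R = "{r. r \<in> set (B (Suc (Suc i))) \<and> mono_dvd (g r) ?m}"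
  have zero: "(\<Sum>q\<in>?Q. c i p q * c (Suc i) q r) = 0" if r: "r \<in> ?R" for r
  proof -
    have "(\<Sum>q\<in>?Q. c i p q * c (Suc i) q r) = (\<Sum>q\<in>set (B (Suc i)). c i p q * c (Suc i) q r)"
    proof (rule sum.mono_neutral_left)
      show "\<forall>q\<in>set (B (Suc i)) - ?Q. c i p q * c (Suc i) q r = 0"
        using r coeff_dvd[of _ "Suc i" r] by (auto dest: mono_dvd_trans)
    qed auto
    then show ?thesis using scalar_complex[OF p] r by simp
  qed
  have "strand ?m (diff_act i (diff_act (Suc i) u)) p
      = (\<Sum>q\<in>?Q. c i p q * (\<Sum>r\<in>?R. c (Suc i) q r * strand ?m u r))"
    unfolding strand_diff_act[OF p mono_dvd_add]
    by (intro sum.cong refl) (simp add: strand_diff_act)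
  also have "\<dots> = (\<Sum>r\<in>?R. (\<Sum>q\<in>?Q. c i p q * c (Suc i) q r) * strand ?m u r)"
    unfolding sum_distrib_left sum_distrib_right mult.assoc by (rule sum.swap)
  also have "\<dots> = 0" using zero by (intro sum.neutral) simp
  finally show "Poly_Mapping.lookup (diff_act i (diff_act (Suc i) u) p) s = Poly_Mapping.lookup 0 s"
    by (simp add: lookup_strand)
qed

lemma mat_kernel_diff_mat:
  "mat_kernel (diff_mat i) \<inter> free_mod V (length (degs (Suc i)))
    = (\<lambda>u. diff_mat (Suc i) *\<^sub>v u) ` free_mod V (length (degs (Suc (Suc i))))"
proof (intro equalityI subsetI)
  fix w assume w: "w \<in> mat_kernel (diff_mat i) \<inter> free_mod V (length (degs (Suc i)))"
  then obtain t where t: "w = vec (length (B (Suc i))) (\<lambda>l. t (B (Suc i) ! l))"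
      "\<And>b. b \<in> set (B (Suc i)) \<Longrightarrow> t b \<in> carrier (mpoly_ring V)"
    using free_mod_family by blast
  have "diff_mat i *\<^sub>v w = 0\<^sub>v (length (B i))"
    using w by (auto simp: mat_kernel_def diff_mat_def)
  then have vec0: "vec (length (B i)) (\<lambda>l. diff_act i t (B i ! l)) = 0\<^sub>v (length (B i))"
    by (simp add: t(1) diff_mat_mult)
  have zero: "diff_act i t p = 0" if p: "p \<in> set (B i)" for p
  proof -
    obtain l where l: "l < length (B i)" "p = B i ! l" using p unfolding in_set_conv_nth by blast
    then show ?thesis using arg_cong[OF vec0, of "\<lambda>v. v $ l"] by simp
  qed
  have "\<exists>u. (\<forall>b. u b \<in> carrier (mpoly_ring V)) \<and> (\<forall>p\<in>set (B (Suc i)). diff_act (Suc i) u p = t p)"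
  proof (rule diff_act_preimage[OF t(2)])
    fix m
    show "\<exists>x. \<forall>p. p \<in> set (B (Suc i)) \<longrightarrow> mono_dvd (g p) m \<longrightarrow>
      strand m t p = (\<Sum>q | q \<in> set (B (Suc (Suc i))) \<and> mono_dvd (g q) m. c (Suc i) p q * x q)"
    proof (rule scalar_exact)
      fix p assume "p \<in> set (B i)" "mono_dvd (g p) m"
      moreover from this have "strand m (diff_act i t) p = 0"
        using zero by (simp add: strand_def)
      ultimately show "(\<Sum>q | q \<in> set (B (Suc i)) \<and> mono_dvd (g q) m. c i p q * strand m t q) = 0"
        using strand_diff_act[of p i m t] by metis
    qed
  qed
  then obtain u where u: "\<And>b. u b \<in> carrier (mpoly_ring V)"
    "\<And>p. p \<in> set (B (Suc i)) \<Longrightarrow> diff_act (Suc i) u p = t p" by blast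
  have "w = diff_mat (Suc i) *\<^sub>v vec (length (B (Suc (Suc i)))) (\<lambda>l. u (B (Suc (Suc i)) ! l))"
    unfolding diff_mat_mult t(1) by (rule eq_vecI) (auto simp: u(2))
  moreover have "vec (length (B (Suc (Suc i)))) (\<lambda>l. u (B (Suc (Suc i)) ! l)) \<in> free_mod V (length (degs (Suc (Suc i))))"
    by (rule family_free_mod[OF u(1)])
  ultimately show "w \<in> (\<lambda>u. diff_mat (Suc i) *\<^sub>v u) ` free_mod V (length (degs (Suc (Suc i))))"
    by blast
next
  fix w assume "w \<in> (\<lambda>u. diff_mat (Suc i) *\<^sub>v u) ` free_mod V (length (degs (Suc (Suc i))))"
  then obtain w' where w': "w = diff_mat (Suc i) *\<^sub>v w'" "w' \<in> free_mod V (length (degs (Suc (Suc i))))"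
    by blast
  from free_mod_family[OF w'(2)] obtain u where u: "w' = vec (length (B (Suc (Suc i)))) (\<lambda>l. u (B (Suc (Suc i)) ! l))"
    "\<And>b. b \<in> set (B (Suc (Suc i))) \<Longrightarrow> u b \<in> carrier (mpoly_ring V)" by blast
  from w'(1) have w: "w = vec (length (B (Suc i))) (\<lambda>l. diff_act (Suc i) u (B (Suc i) ! l))"
    unfolding u(1) diff_mat_mult .
  have "w \<in> free_mod V (length (degs (Suc i)))"
    unfolding w by (intro family_free_mod diff_act_carrier u(2))
  moreover have "diff_mat i *\<^sub>v w = 0\<^sub>v (length (B i))"
    unfolding w diff_mat_mult by (rule eq_vecI) (auto simp: diff_act_diff_act)
  then have "w \<in> mat_kernel (diff_mat i)"
    by (intro mat_kernelI[of _ "length (B i)" "length (B (Suc i))"]) (auto simp: w diff_mat_def)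
  ultimately show "w \<in> mat_kernel (diff_mat i) \<inter> free_mod V (length (degs (Suc i)))" by blast
qed

lemma image_diff_mat_zero:
  "{(diff_mat 0 *\<^sub>v u) $ 0 | u. u \<in> free_mod V (length (degs (Suc 0)))}
    = {f \<in> carrier (mpoly_ring V). \<forall>m\<in>Poly_Mapping.keys f. \<exists>q\<in>set (B (Suc 0)). mono_dvd (g q) m}"
  (is "_ = ?J")
proof -
  obtain b0 where b0: "B 0 = [b0]" "g b0 = 0" using level_zero by (cases "B 0") auto
  have mult: "(diff_mat 0 *\<^sub>v vec (length (B (Suc 0))) (\<lambda>l. u (B (Suc 0) ! l))) $ 0 = diff_act 0 u b0" for u
    unfolding diff_mat_mult by (simp add: b0)
  have dvd0: "mono_dvd (g b0) m" for m by (simp add: b0 mono_dvd_def)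
  have strand0: "strand m t b0 = Poly_Mapping.lookup (t b0) m" for m t
    using lookup_strand[of t b0 m] by (simp add: b0)
  show ?thesis
  proof (intro equalityI subsetI)
    fix f assume "f \<in> {(diff_mat 0 *\<^sub>v u) $ 0 | u. u \<in> free_mod V (length (degs (Suc 0)))}"
    then obtain w where w: "f = (diff_mat 0 *\<^sub>v w) $ 0" "w \<in> free_mod V (length (degs (Suc 0)))" by blast
    from free_mod_family[OF w(2)] obtain u where u: "w = vec (length (B (Suc 0))) (\<lambda>l. u (B (Suc 0) ! l))"
      "\<And>b. b \<in> set (B (Suc 0)) \<Longrightarrow> u b \<in> carrier (mpoly_ring V)" by blast
    have f: "f = diff_act 0 u b0" using w u mult by simp
    then have "f \<in> carrier (mpoly_ring V)" using diff_act_carrier[of b0 0 u] u b0 by simp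
    moreover have "\<exists>q\<in>set (B (Suc 0)). mono_dvd (g q) m" if "m \<in> Poly_Mapping.keys f" for m
    proof -
      have "strand m (diff_act 0 u) b0 \<noteq> 0" using that f strand0 by (simp add: in_keys_iff)
      then have "{q. q \<in> set (B (Suc 0)) \<and> mono_dvd (g q) m} \<noteq> {}"
        using strand_diff_act[of b0 0 m u] b0 dvd0 by (auto simp del: Collect_empty_eq)
      then show ?thesis by blast
    qed
    ultimately show "f \<in> ?J" by blast
  next
    fix f :: "('v, 'k) mpoly" assume f: "f \<in> ?J"
    have "\<exists>u. (\<forall>b. u b \<in> carrier (mpoly_ring V)) \<and> (\<forall>p\<in>set (B 0). diff_act 0 u p = f)"
    proof (rule diff_act_preimage[of 0 "\<lambda>_. f"])
      fix m
      show "\<exists>x. \<forall>p. p \<in> set (B 0) \<longrightarrow> mono_dvd (g p) m \<longrightarrow>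
        strand m (\<lambda>_. f) p = (\<Sum>q | q \<in> set (B (Suc 0)) \<and> mono_dvd (g q) m. c 0 p q * x q)"
      proof (cases "m \<in> Poly_Mapping.keys f")
        case True
        then obtain q0 where q0: "q0 \<in> set (B (Suc 0))" "mono_dvd (g q0) m" using f by blast
        \<comment> \<open>A single generator dividing \<open>m\<close> suffices; it carries the
          whole coefficient of \<open>f\<close> at \<open>m\<close>.\<close>
        let ?x = "\<lambda>q. if q = q0 then Poly_Mapping.lookup f m / c 0 b0 q0 else 0"
        have "(\<Sum>q | q \<in> set (B (Suc 0)) \<and> mono_dvd (g q) m. c 0 b0 q * ?x q)
            = (\<Sum>q | q \<in> set (B (Suc 0)) \<and> mono_dvd (g q) m. if q = q0 then Poly_Mapping.lookup f m else 0)"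
          using scalar_surj[OF q0(1)] b0 by (intro sum.cong) auto
        also have "\<dots> = strand m (\<lambda>_. f) b0"
          using q0 strand0[of m "\<lambda>_. f"] by simp
        finally show ?thesis using b0 by (intro exI[of _ ?x]) simp
      next
        case False
        then show ?thesis using b0 strand0[of m "\<lambda>_. f"] by (intro exI[of _ "\<lambda>_. 0"]) (simp add: in_keys_iff)
      qed
    qed (use f in blast)
    then obtain u where u: "\<And>b. u b \<in> carrier (mpoly_ring V)" "diff_act 0 u b0 = f" using b0 by auto
    let ?w = "vec (length (B (Suc 0))) (\<lambda>l. u (B (Suc 0) ! l))"
    have "?w \<in> free_mod V (length (degs (Suc 0)))" by (rule family_free_mod[OF u(1)])
    moreover have "f = (diff_mat 0 *\<^sub>v ?w) $ 0" using mult u by simp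
    ultimately show "f \<in> {(diff_mat 0 *\<^sub>v u) $ 0 | u. u \<in> free_mod V (length (degs (Suc 0)))}" by blast
  qed
qed

text \<open>Level 0 is the target \<open>R\<close>, so the free modules of the resolution start at
  level 1. A nonzero entry has a nontrivial monomial because the two degrees differ.\<close>

lemma minimal_resolution:
  "minimal_graded_free_resolution V
    {f \<in> carrier (mpoly_ring V). \<forall>m\<in>Poly_Mapping.keys f. \<exists>q\<in>set (B (Suc 0)). mono_dvd (g q) m}
    (\<lambda>i. degs (Suc i)) diff_mat"
  unfolding minimal_graded_free_resolution_def
proof (intro conjI allI ballI)
  have "degs 0 = [0]" using level_zero by (auto simp: degs_def monom_deg_def)
  then show "graded_hom V (degs (Suc 0)) [0] (diff_mat 0)" using graded_hom_diff_mat[of 0] by simp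
  fix i a assume "a \<in> elements_mat (diff_mat (Suc i))"
  then obtain l j where lj: "l < length (B (Suc i))" "j < length (B (Suc (Suc i)))"
    "a = diff_entry (Suc i) (B (Suc i) ! l) (B (Suc (Suc i)) ! j)"
    by (auto simp: elements_mat_def diff_mat_def)
  define p q where "p = B (Suc i) ! l" and "q = B (Suc (Suc i)) ! j"
  have pq: "p \<in> set (B (Suc i))" "q \<in> set (B (Suc (Suc i)))" "a = diff_entry (Suc i) p q"
    using lj by (auto simp: p_def q_def)
  show "Poly_Mapping.lookup a 0 = 0"
  proof (cases "c (Suc i) p q = 0")
    case True
    then show ?thesis using pq by (simp add: diff_entry_def)
  next
    case False
    then obtain r where "g q = g p + r" using coeff_dvd[OF pq(1,2)] by (auto simp: mono_dvd_def)
    moreover have "g p \<noteq> g q" using coeff_minimal pq False by blast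
    ultimately show ?thesis by (simp add: pq(3) diff_entry_def lookup_single)
  qed
qed (fact graded_hom_diff_mat mat_kernel_diff_mat image_diff_mat_zero)+

end


section \<open>Graded homomorphisms\<close>

lemma mpoly_ring_diff_closed:
  "p \<in> carrier (mpoly_ring V) \<Longrightarrow> q \<in> carrier (mpoly_ring V) \<Longrightarrow> p - q \<in> carrier (mpoly_ring V)"
  using mpoly_ring_closed(4)[of p V "- q"] mpoly_ring_closed(3)[of q V] by simp

lemma keys_mult_deg:
  assumes "m \<in> Poly_Mapping.keys (p * q)"
  obtains a b where "a \<in> Poly_Mapping.keys p" "b \<in> Poly_Mapping.keys q" "monom_deg m = monom_deg a + monom_deg b"
  using assms Poly_Mapping.keys_mult[of p q] by (auto simp: monom_deg_add)

lemma homogeneous_mult: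
  assumes "homogeneous d p" "homogeneous e q"
  shows "homogeneous (d + e) (p * q)"
  unfolding homogeneous_def
proof
  fix m assume "m \<in> Poly_Mapping.keys (p * q)"
  then obtain a b where "a \<in> Poly_Mapping.keys p" "b \<in> Poly_Mapping.keys q" "monom_deg m = monom_deg a + monom_deg b"
    by (rule keys_mult_deg)
  then show "int (monom_deg m) = d + e" using assms by (simp add: homogeneous_def)
qed

lemma homogeneous_add: "homogeneous d p \<Longrightarrow> homogeneous d q \<Longrightarrow> homogeneous d (p + q)"
  using Poly_Mapping.keys_add[of p q] by (auto simp: homogeneous_def)

lemma homogeneous_zero: "homogeneous d 0"
  by (simp add: homogeneous_def)

lemma homogeneous_one: "homogeneous 0 1"
  by (simp add: homogeneous_def monom_deg_def flip: single_one)

lemma homogeneous_uminus: "homogeneous d p \<Longrightarrow> homogeneous d (- p)"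
  by (simp add: homogeneous_def in_keys_iff)

lemma homogeneous_diff: "homogeneous d p \<Longrightarrow> homogeneous d q \<Longrightarrow> homogeneous d (p - q)"
  using homogeneous_add[of d p "- q"] homogeneous_uminus[of d q] by simp

lemma homogeneous_sum: "(\<And>x. x \<in> X \<Longrightarrow> homogeneous d (f x)) \<Longrightarrow> homogeneous d (sum f X)"
  by (induction X rule: infinite_finite_induct) (auto simp: homogeneous_zero homogeneous_add)

section \<open>Homogeneous components and degree preserving matrices\<close>

definition homog_comp :: "int \<Rightarrow> ('v, 'k::field) mpoly \<Rightarrow> ('v, 'k) mpoly" where
  "homog_comp d p = Abs_poly_mapping (\<lambda>m. if int (monom_deg m) = d then Poly_Mapping.lookup p m else 0)"

lemma lookup_homog_comp:
  "Poly_Mapping.lookup (homog_comp d p) m = (if int (monom_deg m) = d then Poly_Mapping.lookup p m else 0)"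
proof -
  have "finite {m. (if int (monom_deg m) = d then Poly_Mapping.lookup p m else 0) \<noteq> 0}"
    by (rule finite_subset[of _ "Poly_Mapping.keys p"]) (auto simp: in_keys_iff)
  then show ?thesis by (simp add: homog_comp_def)
qed

lemma homogeneous_homog_comp: "homogeneous d (homog_comp d p)"
  by (auto simp: homogeneous_def in_keys_iff lookup_homog_comp split: if_splits)

lemma homog_comp_closed: "p \<in> carrier (mpoly_ring V) \<Longrightarrow> homog_comp d p \<in> carrier (mpoly_ring V)"
  by (auto simp: mpoly_ring_simps in_keys_iff lookup_homog_comp split: if_splits)

lemma homog_comp_homogeneous: "homogeneous d p \<Longrightarrow> homog_comp d p = p"
  by (rule poly_mapping_eqI) (auto simp: lookup_homog_comp homogeneous_def in_keys_iff)

lemma homog_comp_sum: "homog_comp d (sum f X) = (\<Sum>x\<in>X. homog_comp d (f x))"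
  by (rule poly_mapping_eqI) (simp add: lookup_homog_comp lookup_sum)

text \<open>What remains of \<open>p\<close> without its part of degree \<open>e\<close> contributes
  nothing in degree \<open>d + e\<close> after multiplication by \<open>a\<close>.\<close>

lemma homog_comp_mult:
  assumes "homogeneous d a"
  shows "homog_comp (d + e) (a * p) = a * homog_comp e p"
proof -
  let ?r = "p - homog_comp e p"
  have "homog_comp (d + e) (a * ?r) = 0"
  proof (rule poly_mapping_eqI)
    fix m
    have "Poly_Mapping.lookup (a * ?r) m = 0" if m: "int (monom_deg m) = d + e"
    proof (rule ccontr)
      assume "Poly_Mapping.lookup (a * ?r) m \<noteq> 0"
      then have "m \<in> Poly_Mapping.keys (a * ?r)" by (simp add: in_keys_iff)
      then obtain x y where xy: "x \<in> Poly_Mapping.keys a" "y \<in> Poly_Mapping.keys ?r" "monom_deg m = monom_deg x + monom_deg y"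
        by (rule keys_mult_deg)
      then have "int (monom_deg y) = e" using assms m by (simp add: homogeneous_def)
      then show False using xy(2) by (simp add: in_keys_iff lookup_minus lookup_homog_comp)
    qed
    then show "Poly_Mapping.lookup (homog_comp (d + e) (a * ?r)) m = Poly_Mapping.lookup 0 m"
      by (simp add: lookup_homog_comp)
  qed
  moreover have "a * p = a * homog_comp e p + a * ?r" by (simp flip: distrib_left)
  moreover have "homog_comp D (x + y) = homog_comp D x + homog_comp D y" for D and x y :: "('a, 'b) mpoly"
    by (rule poly_mapping_eqI) (simp add: lookup_homog_comp lookup_add)
  moreover have "homog_comp (d + e) (a * homog_comp e p) = a * homog_comp e p"
    by (intro homog_comp_homogeneous homogeneous_mult assms homogeneous_homog_comp)
  ultimately show ?thesis by simp
qed

text \<open>The constant coefficient is multiplicative: it is reduction modulo the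
  variables.\<close>

lemma lookup_mult_zero:
  fixes p q :: "('v, 'k::field) mpoly"
  shows "Poly_Mapping.lookup (p * q) 0 = Poly_Mapping.lookup p 0 * Poly_Mapping.lookup q 0"
proof -
  have "0 = l + q' \<longleftrightarrow> l = 0 \<and> q' = 0" for l q' :: "'v \<Rightarrow>\<^sub>0 nat"
    by (auto simp: poly_mapping_eq_iff lookup_add fun_eq_iff)
  then have "(\<Sum>q'. Poly_Mapping.lookup q q' when 0 = l + q') = (Poly_Mapping.lookup q 0 when l = 0)" for l
    by (simp add: when_def)
  then show ?thesis by (simp add: lookup_mult mult_when)
qed

lemma elements_mat_subset_iff:
  "elements_mat A \<subseteq> C \<longleftrightarrow> (\<forall>i<dim_row A. \<forall>j<dim_col A. A $$ (i, j) \<in> C)"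
  using elements_matI[of A "dim_row A" "dim_col A"] elements_matD[of _ A] by fastforce

lemma graded_hom_iff:
  "graded_hom V ds ds' A \<longleftrightarrow> A \<in> carrier_mat (length ds') (length ds) \<and>
    (\<forall>p<length ds'. \<forall>q<length ds. A $$ (p, q) \<in> carrier (mpoly_ring V) \<and> homogeneous (ds ! q - ds' ! p) (A $$ (p, q)))"
  unfolding graded_hom_def elements_mat_subset_iff by auto

lemma graded_hom_carrier: "graded_hom V ds ds' A \<Longrightarrow> A \<in> carrier_mat (length ds') (length ds)"
  by (simp add: graded_hom_def)

lemma graded_hom_mult:
  assumes "graded_hom V ds ds' A" "graded_hom V ds' ds'' B"
  shows "graded_hom V ds ds'' (B * A)"
  unfolding graded_hom_iff
proof (intro conjI allI impI)
  note AB = assms[THEN graded_hom_carrier]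
  then show "B * A \<in> carrier_mat (length ds'') (length ds)" by auto
  fix p q assume pq: "p < length ds''" "q < length ds"
  have eq: "(B * A) $$ (p, q) = (\<Sum>j = 0..<length ds'. B $$ (p, j) * A $$ (j, q))"
    using pq AB by (auto simp: scalar_prod_def)
  show "(B * A) $$ (p, q) \<in> carrier (mpoly_ring V)"
    unfolding eq using assms pq by (intro sum_mpoly_ring_closed mpoly_ring_closed) (auto simp: graded_hom_iff)
  have "homogeneous ((ds' ! j - ds'' ! p) + (ds ! q - ds' ! j)) (B $$ (p, j) * A $$ (j, q))" if "j < length ds'" for j
    using assms pq that by (intro homogeneous_mult) (auto simp: graded_hom_iff)
  then show "homogeneous (ds ! q - ds'' ! p) ((B * A) $$ (p, q))"
    unfolding eq by (intro homogeneous_sum) simp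
qed

lemma graded_hom_diff:
  "graded_hom V ds ds' A \<Longrightarrow> graded_hom V ds ds' B \<Longrightarrow> graded_hom V ds ds' (A - B)"
  by (auto simp: graded_hom_iff homogeneous_diff mpoly_ring_diff_closed)

lemma graded_hom_one: "graded_hom V ds ds (1\<^sub>m (length ds))"
  by (auto simp: graded_hom_iff homogeneous_one homogeneous_zero mpoly_ring_closed)

lemma graded_hom_zero: "graded_hom V ds ds' (0\<^sub>m (length ds') (length ds))"
  by (auto simp: graded_hom_iff homogeneous_zero mpoly_ring_closed)

text \<open>Preimages of the columns need not be graded. Replacing each entry by its component of
  the required degree preserves the equation, since the entries of \<open>\<Phi>\<close> and
  \<open>A\<close> are homogeneous.\<close>

lemma graded_lift:
  assumes \<Phi>: "graded_hom V es es' \<Phi>" and A: "graded_hom V ds es' A"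
    and im: "\<And>q. q < length ds \<Longrightarrow> \<exists>u\<in>free_mod V (length es). \<Phi> *\<^sub>v u = col A q"
  shows "\<exists>X. graded_hom V ds es X \<and> \<Phi> * X = A"
proof -
  obtain U where U: "\<And>q. q < length ds \<Longrightarrow> U q \<in> free_mod V (length es) \<and> \<Phi> *\<^sub>v U q = col A q"
    using im by metis
  define X where "X = mat (length es) (length ds) (\<lambda>(i, q). homog_comp (ds ! q - es ! i) (U q $ i))"
  note carr = graded_hom_carrier[OF \<Phi>] graded_hom_carrier[OF A]
  have "U q $ i \<in> carrier (mpoly_ring V)" if "q < length ds" "i < length es" for q i
  proof -
    have "U q $ i \<in> set\<^sub>v (U q)" using U[OF that(1)] that by (auto simp: free_mod_def intro!: vec_setI)
    then show ?thesis using U[OF that(1)] by (auto simp: free_mod_def)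
  qed
  then have "graded_hom V ds es X"
    by (auto simp: graded_hom_iff X_def homogeneous_homog_comp homog_comp_closed)
  moreover have "\<Phi> * X = A"
  proof (rule eq_matI)
    fix p q assume "p < dim_row A" "q < dim_col A"
    then have pq: "p < length es'" "q < length ds" using carr by auto
    have dimU: "dim_vec (U q) = length es" using U[OF pq(2)] by (auto simp: free_mod_def)
    have "A $$ (p, q) = (\<Phi> *\<^sub>v U q) $ p" using U[OF pq(2)] pq carr by auto
    also have "\<dots> = (\<Sum>i = 0..<length es. \<Phi> $$ (p, i) * U q $ i)"
      using pq carr dimU by (auto simp: scalar_prod_def)
    finally have Apq: "A $$ (p, q) = (\<Sum>i = 0..<length es. \<Phi> $$ (p, i) * U q $ i)" .
    have "homogeneous (ds ! q - es' ! p) (A $$ (p, q))" using A pq by (simp add: graded_hom_iff)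
    then have "A $$ (p, q) = homog_comp (ds ! q - es' ! p) (A $$ (p, q))"
      by (simp add: homog_comp_homogeneous)
    also have "\<dots> = (\<Sum>i = 0..<length es. homog_comp (ds ! q - es' ! p) (\<Phi> $$ (p, i) * U q $ i))"
      unfolding Apq by (rule homog_comp_sum)
    also have "\<dots> = (\<Sum>i = 0..<length es. \<Phi> $$ (p, i) * homog_comp (ds ! q - es ! i) (U q $ i))"
    proof (rule sum.cong)
      fix i assume "i \<in> {0..<length es}"
      then have "homogeneous (es ! i - es' ! p) (\<Phi> $$ (p, i))" using \<Phi> pq by (simp add: graded_hom_iff)
      from homog_comp_mult[OF this, of "ds ! q - es ! i" "U q $ i"]
      show "homog_comp (ds ! q - es' ! p) (\<Phi> $$ (p, i) * U q $ i) = \<Phi> $$ (p, i) * homog_comp (ds ! q - es ! i) (U q $ i)"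
        by simp
    qed simp
    also have "\<dots> = (\<Phi> * X) $$ (p, q)"
      using pq carr by (auto simp: scalar_prod_def X_def)
    finally show "(\<Phi> * X) $$ (p, q) = A $$ (p, q)" by simp
  qed (use carr in \<open>auto simp: X_def\<close>)
  ultimately show ?thesis by blast
qed

lemma graded_hom_col_free_mod:
  "graded_hom V ds ds' A \<Longrightarrow> q < length ds \<Longrightarrow> col A q \<in> free_mod V (length ds')"
  by (auto simp: free_mod_def graded_hom_iff vec_set_def)


section \<open>Uniqueness of graded Betti numbers\<close>

text \<open>With \<open>R\<close> as level 0, the lifting step for the map onto \<open>I\<close> and
  the later ones share one indexing. Minimality starts at the map with index 1.\<close>

locale augmented_resolution =
  fixes V :: "'v set" and I :: "('v, 'k::field) mpoly set" and D :: "nat \<Rightarrow> int list"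
    and \<Phi> :: "nat \<Rightarrow> ('v, 'k) mpoly mat"
  assumes D0: "D 0 = [0]"
    and graded: "graded_hom V (D (Suc i)) (D i) (\<Phi> i)"
    and image0: "{(\<Phi> 0 *\<^sub>v u) $ 0 | u. u \<in> free_mod V (length (D (Suc 0)))} = I"
    and exact: "mat_kernel (\<Phi> i) \<inter> free_mod V (length (D (Suc i)))
      = (\<lambda>u. \<Phi> (Suc i) *\<^sub>v u) ` free_mod V (length (D (Suc (Suc i))))"
    and minimal: "p < length (D (Suc i)) \<Longrightarrow> q < length (D (Suc (Suc i))) \<Longrightarrow> Poly_Mapping.lookup (\<Phi> (Suc i) $$ (p, q)) 0 = 0"
begin

lemma carrier: "\<Phi> i \<in> carrier_mat (length (D i)) (length (D (Suc i)))"
  by (rule graded_hom_carrier[OF graded])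

lemma lift_kernel:
  assumes A: "graded_hom V ds (D (Suc i)) A" and zero: "\<Phi> i * A = 0\<^sub>m (length (D i)) (length ds)"
  shows "\<exists>X. graded_hom V ds (D (Suc (Suc i))) X \<and> \<Phi> (Suc i) * X = A"
proof (rule graded_lift[OF graded A])
  fix q assume q: "q < length ds"
  have "\<Phi> i *\<^sub>v col A q = col (\<Phi> i * A) q"
    by (rule col_mult2[OF carrier graded_hom_carrier[OF A] q, symmetric])
  then have "\<Phi> i *\<^sub>v col A q = 0\<^sub>v (length (D i))" using zero q by simp
  then have "col A q \<in> mat_kernel (\<Phi> i)"
    by (rule mat_kernelI[OF carrier col_carrier_vec[OF q graded_hom_carrier[OF A]]])
  then have "col A q \<in> (\<lambda>u. \<Phi> (Suc i) *\<^sub>v u) ` free_mod V (length (D (Suc (Suc i))))"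
    using graded_hom_col_free_mod[OF A q] exact by blast
  then show "\<exists>u\<in>free_mod V (length (D (Suc (Suc i)))). \<Phi> (Suc i) *\<^sub>v u = col A q" by force
qed

lemma lift_ideal:
  assumes A: "graded_hom V ds (D 0) A" and "\<And>q. q < length ds \<Longrightarrow> A $$ (0, q) \<in> I"
  shows "\<exists>X. graded_hom V ds (D (Suc 0)) X \<and> \<Phi> 0 * X = A"
proof (rule graded_lift[OF graded A])
  fix q assume q: "q < length ds"
  obtain u where u: "u \<in> free_mod V (length (D (Suc 0)))" "(\<Phi> 0 *\<^sub>v u) $ 0 = A $$ (0, q)"
    using assms(2)[OF q] image0 by force
  have "\<Phi> 0 *\<^sub>v u = col A q"
    using u carrier[of 0] graded_hom_carrier[OF A] q D0 by (intro eq_vecI) auto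
  then show "\<exists>u\<in>free_mod V (length (D (Suc 0))). \<Phi> 0 *\<^sub>v u = col A q" using u by blast
qed

lemma unit_vec_free_mod: "unit_vec n q \<in> free_mod V n"
  by (auto simp: free_mod_def vec_set_def unit_vec_def mpoly_ring_closed)

lemma mult_unit_vec: "A \<in> carrier_mat nr n \<Longrightarrow> q < n \<Longrightarrow> A *\<^sub>v unit_vec n q = col A (q :: nat)"
  for A :: "('v, 'k) mpoly mat"
  by (intro eq_vecI) auto

lemma complex: "\<Phi> i * \<Phi> (Suc i) = 0\<^sub>m (length (D i)) (length (D (Suc (Suc i))))"
proof (rule mat_col_eqI)
  fix q assume "q < dim_col (0\<^sub>m (length (D i)) (length (D (Suc (Suc i)))) :: ('v, 'k) mpoly mat)"
  then have q: "q < length (D (Suc (Suc i)))" by simp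
  have "col (\<Phi> (Suc i)) q \<in> mat_kernel (\<Phi> i)"
    using exact[of i] mult_unit_vec[OF carrier[of "Suc i"] q] unit_vec_free_mod by (metis IntD1 imageI)
  then have "\<Phi> i *\<^sub>v col (\<Phi> (Suc i)) q = 0\<^sub>v (length (D i))"
    using carrier[of i] by (simp add: mat_kernel_def)
  then show "col (\<Phi> i * \<Phi> (Suc i)) q = col (0\<^sub>m (length (D i)) (length (D (Suc (Suc i))))) q"
    unfolding col_mult2[OF carrier carrier q] using q by simp
qed (use carrier[of i] carrier[of "Suc i"] in auto)

lemma row_in_ideal:
  assumes "q < length (D (Suc 0))"
  shows "\<Phi> 0 $$ (0, q) \<in> I"
proof -
  have "\<Phi> 0 $$ (0, q) = (\<Phi> 0 *\<^sub>v unit_vec (length (D (Suc 0))) q) $ 0"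
    using mult_unit_vec[OF carrier[of 0] assms] carrier[of 0] D0 assms by simp
  then show ?thesis using image0 unit_vec_free_mod by blast
qed

end

lemma augmented_resolution_of_minimal:
  assumes "minimal_graded_free_resolution V I d \<phi>"
  shows "augmented_resolution V I (case_nat [0] d) \<phi>"
proof
  fix i
  show "graded_hom V (case_nat [0] d (Suc i)) (case_nat [0] d i) (\<phi> i)"
    using assms by (cases i) (auto simp: minimal_graded_free_resolution_def)
  fix p q assume pq: "p < length (case_nat [0] d (Suc i))" "q < length (case_nat [0] d (Suc (Suc i)))"
  have "\<phi> (Suc i) \<in> carrier_mat (length (d i)) (length (d (Suc i)))"
    using assms by (auto simp: minimal_graded_free_resolution_def graded_hom_def)
  then have "\<phi> (Suc i) $$ (p, q) \<in> elements_mat (\<phi> (Suc i))"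
    using pq by (intro elements_matI) auto
  then show "Poly_Mapping.lookup (\<phi> (Suc i) $$ (p, q)) 0 = 0"
    using assms by (auto simp: minimal_graded_free_resolution_def)
qed (use assms in \<open>auto simp: minimal_graded_free_resolution_def\<close>)

text \<open>If \<open>Q\<close> were smaller, padding with zeros would give square matrices with
  \<open>?B * ?A = 1\<close>, hence also \<open>?A * ?B = 1\<close>, although \<open>?A\<close> has
  a zero row.\<close>

lemma card_le_of_left_inverse:
  fixes \<alpha> :: "'q \<Rightarrow> 'p \<Rightarrow> 'k::field" and \<beta> :: "'p \<Rightarrow> 'q \<Rightarrow> 'k"
  assumes "finite P" "finite Q"
    and inv: "\<And>p p'. p \<in> P \<Longrightarrow> p' \<in> P \<Longrightarrow> (\<Sum>q\<in>Q. \<beta> p q * \<alpha> q p') = (if p = p' then 1 else 0)"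
  shows "card P \<le> card Q"
proof (rule ccontr)
  assume "\<not> card P \<le> card Q"
  then have less: "card Q < card P" by simp
  let ?n = "card P" and ?m = "card Q"
  obtain f where f: "bij_betw f {0..<?n} P" using ex_bij_betw_nat_finite[OF assms(1)] by blast
  obtain h where h: "bij_betw h {0..<?m} Q" using ex_bij_betw_nat_finite[OF assms(2)] by blast
  let ?A = "mat ?n ?n (\<lambda>(i, j). if i < ?m then \<alpha> (h i) (f j) else 0)"
  let ?B = "mat ?n ?n (\<lambda>(i, j). if j < ?m then \<beta> (f i) (h j) else 0)"
  have "?B * ?A = 1\<^sub>m ?n"
  proof (rule eq_matI)
    fix i j assume "i < dim_row (1\<^sub>m ?n :: 'k mat)" "j < dim_col (1\<^sub>m ?n :: 'k mat)"
    then have ij: "i < ?n" "j < ?n" by auto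
    have fij: "f i \<in> P" "f j \<in> P" using f ij by (auto simp: bij_betw_def)
    have "(?B * ?A) $$ (i, j) = (\<Sum>l = 0..<?n. if l < ?m then \<beta> (f i) (h l) * \<alpha> (h l) (f j) else 0)"
      using ij by (auto simp: scalar_prod_def intro!: sum.cong)
    also have "\<dots> = (\<Sum>l = 0..<?m. \<beta> (f i) (h l) * \<alpha> (h l) (f j))"
      by (rule sum.mono_neutral_cong_right) (use less in auto)
    also have "\<dots> = (\<Sum>q\<in>Q. \<beta> (f i) q * \<alpha> q (f j))"
      by (rule sum.reindex_bij_betw[OF h])
    also have "\<dots> = (if f i = f j then 1 else 0)" by (rule inv[OF fij])
    also have "f i = f j \<longleftrightarrow> i = j"
      using f ij by (auto simp: bij_betw_def inj_on_def)
    finally show "(?B * ?A) $$ (i, j) = 1\<^sub>m ?n $$ (i, j)" using ij by simp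
  qed auto
  then have "?A * ?B = 1\<^sub>m ?n"
    by (rule mat_mult_left_right_inverse[rotated 2]) auto
  then have "(?A * ?B) $$ (?m, ?m) = 1" using less by simp
  moreover have "(?A * ?B) $$ (?m, ?m) = 0" using less by (simp add: scalar_prod_def)
  ultimately show False by simp
qed

lemma count_list_card: "count_list xs j = card {i. i < length xs \<and> xs ! i = j}"
  by (simp add: count_list_eq_length_filter length_filter_conv_card eq_commute[of j])

lemma zero_in_keys_homogeneous:
  "homogeneous d p \<Longrightarrow> Poly_Mapping.lookup p 0 \<noteq> 0 \<Longrightarrow> d = 0"
  by (force simp: homogeneous_def monom_deg_def in_keys_iff)

locale two_resolutions =
  F: augmented_resolution V I D \<Phi> + G: augmented_resolution V I D' \<Phi>'
  for V :: "'v set" and I :: "('v, 'k::field) mpoly set" and D \<Phi> D' \<Phi>'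
begin

text \<open>Chain maps \<open>a\<close> and \<open>b\<close> between the resolutions and a homotopy \<open>h\<close> from \<open>b a\<close> to the identity, as
  far as level \<open>i\<close>; the primed maps are those one level up.\<close>

definition stage :: "nat \<Rightarrow> ('v, 'k) mpoly mat \<Rightarrow> ('v, 'k) mpoly mat \<Rightarrow> ('v, 'k) mpoly mat \<Rightarrow> ('v, 'k) mpoly mat \<Rightarrow> ('v, 'k) mpoly mat \<Rightarrow> bool" where
  "stage i a a' b b' h \<longleftrightarrow> graded_hom V (D i) (D' i) a \<and> graded_hom V (D (Suc i)) (D' (Suc i)) a'
    \<and> graded_hom V (D' i) (D i) b \<and> graded_hom V (D' (Suc i)) (D (Suc i)) b'
    \<and> graded_hom V (D i) (D (Suc i)) h
    \<and> \<Phi>' i * a' = a * \<Phi> i \<and> \<Phi> i * b' = b * \<Phi>' i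
    \<and> b * a * \<Phi> i = \<Phi> i + \<Phi> i * h * \<Phi> i
    \<and> (\<forall>p<length (D (Suc i)). \<forall>q<length (D (Suc i)). Poly_Mapping.lookup ((h * \<Phi> i) $$ (p, q)) 0 = 0)"

text \<open>At the bottom both maps are the identity of \<open>R\<close> and \<open>h = 0\<close>.
  The choice of \<open>h\<close> gives the clause on constant coefficients here, where minimality
  says nothing about the entries of \<open>\<Phi> 0\<close>.\<close>

lemma stage_0: "\<exists>a a' b b' h. stage 0 a a' b b' h"
proof -
  have len: "length (D 0) = 1" "length (D' 0) = 1" "D' 0 = D 0" by (simp_all add: F.D0 G.D0)
  let ?one = "1\<^sub>m 1 :: ('v, 'k) mpoly mat" and ?h = "0\<^sub>m (length (D (Suc 0))) 1 :: ('v, 'k) mpoly mat"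
  obtain a' where a': "graded_hom V (D (Suc 0)) (D' (Suc 0)) a'" "\<Phi>' 0 * a' = \<Phi> 0"
    using G.lift_ideal[of "D (Suc 0)" "\<Phi> 0"] F.graded[of 0] F.row_in_ideal len by auto
  obtain b' where b': "graded_hom V (D' (Suc 0)) (D (Suc 0)) b'" "\<Phi> 0 * b' = \<Phi>' 0"
    using F.lift_ideal[of "D' (Suc 0)" "\<Phi>' 0"] G.graded[of 0] G.row_in_ideal len by auto
  have one: "graded_hom V (D 0) (D 0) ?one" using graded_hom_one[of V "D 0"] len by simp
  have h: "graded_hom V (D 0) (D (Suc 0)) ?h" using graded_hom_zero[of V "D 0" "D (Suc 0)"] len by simp
  have carr: "\<Phi> 0 \<in> carrier_mat 1 (length (D (Suc 0)))" "\<Phi>' 0 \<in> carrier_mat 1 (length (D' (Suc 0)))"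
    using F.carrier[of 0] G.carrier[of 0] len by auto
  have "stage 0 ?one a' ?one b' ?h"
    unfolding stage_def using a' b' one h carr len by simp
  then show ?thesis by blast
qed

text \<open>A stage keeps the homotopy identity only after composition with \<open>\<Phi> i\<close>.
  This loses the term coming from below, yet suffices to place the next error in a kernel.\<close>

lemma stage_Suc:
  assumes "stage i a a' b b' h"
  shows "\<exists>a'' b'' h'. stage (Suc i) a' a'' b' b'' h'
    \<and> b' * a' = 1\<^sub>m (length (D (Suc i))) + h * \<Phi> i + \<Phi> (Suc i) * h'"
proof -
  let ?n0 = "length (D i)" and ?n1 = "length (D (Suc i))" and ?n2 = "length (D (Suc (Suc i)))"
  let ?m0 = "length (D' i)" and ?m1 = "length (D' (Suc i))" and ?m2 = "length (D' (Suc (Suc i)))"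
  have g: "graded_hom V (D i) (D' i) a" "graded_hom V (D (Suc i)) (D' (Suc i)) a'"
    "graded_hom V (D' i) (D i) b" "graded_hom V (D' (Suc i)) (D (Suc i)) b'"
    "graded_hom V (D i) (D (Suc i)) h"
    and com: "\<Phi>' i * a' = a * \<Phi> i" "\<Phi> i * b' = b * \<Phi>' i"
    and hom: "b * a * \<Phi> i = \<Phi> i + \<Phi> i * h * \<Phi> i"
    using assms by (auto simp: stage_def)
  note c = g[THEN graded_hom_carrier]
  have "\<Phi>' i * (a' * \<Phi> (Suc i)) = \<Phi>' i * a' * \<Phi> (Suc i)"
    by (rule assoc_mult_mat[symmetric]) (rule c G.carrier F.carrier)+
  also have "\<dots> = a * (\<Phi> i * \<Phi> (Suc i))"
    unfolding com by (rule assoc_mult_mat) (rule c G.carrier F.carrier)+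
  also have "\<dots> = 0\<^sub>m ?m0 ?n2" unfolding F.complex by (rule right_mult_zero_mat[OF c(1)])
  finally obtain a'' where a'': "graded_hom V (D (Suc (Suc i))) (D' (Suc (Suc i))) a''" "\<Phi>' (Suc i) * a'' = a' * \<Phi> (Suc i)"
    using G.lift_kernel[OF graded_hom_mult[OF F.graded g(2)]] by blast
  have "\<Phi> i * (b' * \<Phi>' (Suc i)) = \<Phi> i * b' * \<Phi>' (Suc i)"
    by (rule assoc_mult_mat[symmetric]) (rule c G.carrier F.carrier)+
  also have "\<dots> = b * (\<Phi>' i * \<Phi>' (Suc i))"
    unfolding com by (rule assoc_mult_mat) (rule c G.carrier F.carrier)+
  also have "\<dots> = 0\<^sub>m ?n0 ?m2" unfolding G.complex by (rule right_mult_zero_mat[OF c(3)])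
  finally obtain b'' where b'': "graded_hom V (D' (Suc (Suc i))) (D (Suc (Suc i))) b''" "\<Phi> (Suc i) * b'' = b' * \<Phi>' (Suc i)"
    using F.lift_kernel[OF graded_hom_mult[OF G.graded g(4)]] by blast
  \<comment> \<open>The part of the homotopy identity still to be accounted for; it is killed by
    \<open>\<Phi> i\<close>, and its lift along \<open>\<Phi> (Suc i)\<close> is the next
    homotopy.\<close>
  define E where "E = b' * a' - 1\<^sub>m ?n1 - h * \<Phi> i"
  have E: "graded_hom V (D (Suc i)) (D (Suc i)) E"
    unfolding E_def by (intro graded_hom_diff graded_hom_mult[OF g(2,4)] graded_hom_one graded_hom_mult[OF F.graded g(5)])
  have ba: "b' * a' \<in> carrier_mat ?n1 ?n1" and h\<Phi>: "h * \<Phi> i \<in> carrier_mat ?n1 ?n1"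
    using c F.carrier[of i] by (auto intro: mult_carrier_mat)
  have "\<Phi> i * (b' * a') = \<Phi> i * b' * a'"
    by (rule assoc_mult_mat[symmetric]) (rule c G.carrier F.carrier)+
  also have "\<dots> = b * (\<Phi>' i * a')"
    unfolding com(2) by (rule assoc_mult_mat) (rule c G.carrier F.carrier)+
  also have "\<dots> = b * a * \<Phi> i"
    unfolding com(1) by (rule assoc_mult_mat[symmetric]) (rule c G.carrier F.carrier)+
  also have "\<dots> = \<Phi> i + \<Phi> i * (h * \<Phi> i)"
    unfolding hom by (subst assoc_mult_mat[OF F.carrier c(5) F.carrier]) simp
  finally have "\<Phi> i * (b' * a') = \<Phi> i + \<Phi> i * (h * \<Phi> i)" .
  moreover have "\<Phi> i * E = \<Phi> i * (b' * a') - \<Phi> i - \<Phi> i * (h * \<Phi> i)"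
  proof -
    have "b' * a' - 1\<^sub>m ?n1 \<in> carrier_mat ?n1 ?n1" by (rule minus_carrier_mat) simp
    from mult_minus_distrib_mat[OF F.carrier[of i] this h\<Phi>]
    show ?thesis
      unfolding E_def mult_minus_distrib_mat[OF F.carrier[of i] ba one_carrier_mat] right_mult_one_mat[OF F.carrier] .
  qed
  moreover have "\<Phi> i * (h * \<Phi> i) \<in> carrier_mat ?n0 ?n1" using F.carrier[of i] h\<Phi> by (rule mult_carrier_mat)
  ultimately have "\<Phi> i * E = 0\<^sub>m ?n0 ?n1"
    using F.carrier[of i] by (auto intro!: eq_matI)
  then obtain h' where h': "graded_hom V (D (Suc i)) (D (Suc (Suc i))) h'" "\<Phi> (Suc i) * h' = E"
    using F.lift_kernel[OF E] by blast
  have \<Phi>h: "\<Phi> (Suc i) * h' \<in> carrier_mat ?n1 ?n1"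
    using F.carrier graded_hom_carrier[OF h'(1)] by (rule mult_carrier_mat)
  have eq: "b' * a' = 1\<^sub>m ?n1 + h * \<Phi> i + \<Phi> (Suc i) * h'"
  proof -
    have "X = 1\<^sub>m n + Y + (X - 1\<^sub>m n - Y)" if "X \<in> carrier_mat n n" "Y \<in> carrier_mat n n"
      for X Y :: "('v, 'k) mpoly mat" and n
      using that by (intro eq_matI) auto
    from this[OF ba h\<Phi>] show ?thesis unfolding h'(2) E_def .
  qed
  have "b' * a' * \<Phi> (Suc i) = \<Phi> (Suc i) + h * \<Phi> i * \<Phi> (Suc i) + \<Phi> (Suc i) * h' * \<Phi> (Suc i)"
    unfolding eq using h\<Phi> \<Phi>h F.carrier[of "Suc i"]
    by (simp add: add_mult_distrib_mat[of _ ?n1 ?n1 _ _ ?n2] del: assoc_mult_mat)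
  also have "h * \<Phi> i * \<Phi> (Suc i) = h * (\<Phi> i * \<Phi> (Suc i))"
    by (rule assoc_mult_mat) (rule c F.carrier)+
  also have "\<dots> = 0\<^sub>m ?n1 ?n2" unfolding F.complex by (rule right_mult_zero_mat[OF c(5)])
  also have "\<Phi> (Suc i) + 0\<^sub>m ?n1 ?n2 = \<Phi> (Suc i)" using F.carrier[of "Suc i"] by simp
  finally have hom': "b' * a' * \<Phi> (Suc i) = \<Phi> (Suc i) + \<Phi> (Suc i) * h' * \<Phi> (Suc i)" .
  have "Poly_Mapping.lookup ((h' * \<Phi> (Suc i)) $$ (p, q)) 0 = 0" if "p < ?n2" "q < ?n2" for p q
  proof -
    have "(h' * \<Phi> (Suc i)) $$ (p, q) = (\<Sum>j = 0..<?n1. h' $$ (p, j) * \<Phi> (Suc i) $$ (j, q))"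
      using that F.carrier[of "Suc i"] graded_hom_carrier[OF h'(1)] by (auto simp: scalar_prod_def)
    then show ?thesis using that by (simp add: lookup_sum lookup_mult_zero F.minimal)
  qed
  then have "stage (Suc i) a' a'' b' b'' h'"
    unfolding stage_def using a'' b'' h' g com hom' by simp
  then show ?thesis using eq by blast
qed

lemma stages: "\<exists>a a' b b' h. stage i a a' b b' h"
proof (induction i)
  case (Suc i)
  then show ?case using stage_Suc by blast
qed (rule stage_0)

text \<open>Modulo the variables both homotopy terms disappear, so \<open>b\<close> is a left
  inverse of \<open>a\<close> over the field. The maps preserve degrees, so this holds on the
  summands of degree \<open>j\<close> alone.\<close>

lemma count_list_le: "count_list (D (Suc i)) j \<le> count_list (D' (Suc i)) j"
proof -
  obtain a0 a b0 b h where st: "stage i a0 a b0 b h" using stages by blast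
  obtain a2 b2 h' where h': "stage (Suc i) a a2 b b2 h'" and
    eq: "b * a = 1\<^sub>m (length (D (Suc i))) + h * \<Phi> i + \<Phi> (Suc i) * h'"
    using stage_Suc[OF st] by blast
  let ?n = "length (D (Suc i))" and ?m = "length (D' (Suc i))" and ?n2 = "length (D (Suc (Suc i)))"
  have g: "graded_hom V (D (Suc i)) (D' (Suc i)) a" "graded_hom V (D' (Suc i)) (D (Suc i)) b"
    and gh: "graded_hom V (D (Suc i)) (D (Suc (Suc i))) h'" "graded_hom V (D i) (D (Suc i)) h"
    using st h' by (auto simp: stage_def)
  note c = g[THEN graded_hom_carrier] gh[THEN graded_hom_carrier]
  let ?a = "\<lambda>q p. Poly_Mapping.lookup (a $$ (q, p)) 0" and ?b = "\<lambda>p q. Poly_Mapping.lookup (b $$ (p, q)) 0"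
  have inv: "(\<Sum>q = 0..<?m. ?b p q * ?a q p') = (if p = p' then 1 else 0)" if pp: "p < ?n" "p' < ?n" for p p'
  proof -
    have "(b * a) $$ (p, p') = (\<Sum>q = 0..<?m. b $$ (p, q) * a $$ (q, p'))"
      using pp c by (auto simp: scalar_prod_def)
    then have "(\<Sum>q = 0..<?m. ?b p q * ?a q p') = Poly_Mapping.lookup ((b * a) $$ (p, p')) 0"
      by (simp add: lookup_sum lookup_mult_zero)
    also have "(b * a) $$ (p, p') = 1\<^sub>m ?n $$ (p, p') + (h * \<Phi> i) $$ (p, p') + (\<Phi> (Suc i) * h') $$ (p, p')"
      unfolding eq using pp c F.carrier[of i] F.carrier[of "Suc i"] by auto
    also have "(\<Phi> (Suc i) * h') $$ (p, p') = (\<Sum>j = 0..<?n2. \<Phi> (Suc i) $$ (p, j) * h' $$ (j, p'))"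
      using pp F.carrier[of "Suc i"] c by (auto simp: scalar_prod_def)
    finally show ?thesis
      using pp st by (simp add: lookup_add lookup_sum lookup_mult_zero F.minimal stage_def lookup_one)
  qed
  let ?P = "{p. p < ?n \<and> D (Suc i) ! p = j}" and ?Q = "{q. q < ?m \<and> D' (Suc i) ! q = j}"
  have "card ?P \<le> card ?Q"
  proof (rule card_le_of_left_inverse[of _ _ ?b ?a])
    fix p p' assume pp: "p \<in> ?P" "p' \<in> ?P"
    then have pp': "p' < ?n" by simp
    \<comment> \<open>A homogeneous entry with nonzero constant coefficient has degree 0, so it
      connects summands of equal degree.\<close>
    have "?a q p' = 0" if "q < ?m" "D' (Suc i) ! q \<noteq> j" for q
    proof (rule ccontr)
      assume "?a q p' \<noteq> 0"
      moreover have "homogeneous (D (Suc i) ! p' - D' (Suc i) ! q) (a $$ (q, p'))"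
        using g(1) that(1) pp' by (simp add: graded_hom_iff)
      ultimately have "D (Suc i) ! p' - D' (Suc i) ! q = 0" using zero_in_keys_homogeneous by blast
      then show False using that pp by simp
    qed
    then have "(\<Sum>q\<in>?Q. ?b p q * ?a q p') = (\<Sum>q = 0..<?m. ?b p q * ?a q p')"
      by (intro sum.mono_neutral_left) auto
    then show "(\<Sum>q\<in>?Q. ?b p q * ?a q p') = (if p = p' then 1 else 0)" using inv pp by simp
  qed auto
  then show ?thesis by (simp add: count_list_card)
qed

end

lemma betti_unique:
  assumes "minimal_graded_free_resolution V I d \<phi>" "minimal_graded_free_resolution V I d' \<phi>'"
  shows "count_list (d i) j = count_list (d' i) j"
proof -
  interpret F: augmented_resolution V I "case_nat [0] d" \<phi> by (rule augmented_resolution_of_minimal[OF assms(1)])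
  interpret G: augmented_resolution V I "case_nat [0] d'" \<phi>' by (rule augmented_resolution_of_minimal[OF assms(2)])
  interpret FG: two_resolutions V I "case_nat [0] d" \<phi> "case_nat [0] d'" \<phi>' ..
  interpret GF: two_resolutions V I "case_nat [0] d'" \<phi>' "case_nat [0] d" \<phi> ..
  show ?thesis using FG.count_list_le[of i j] GF.count_list_le[of i j] by simp
qed

lemma betti_eq:
  assumes "minimal_graded_free_resolution V I d \<phi>"
  shows "betti V I i j = count_list (d i) j"
  unfolding betti_def
proof (rule the_equality)
  fix b assume "\<exists>d \<phi>. minimal_graded_free_resolution V I d \<phi> \<and> b = count_list (d i) j"
  then obtain d' \<phi>' where "minimal_graded_free_resolution V I d' \<phi>'" "b = count_list (d' i) j" by blast
  then show "b = count_list (d i) j" using betti_unique[OF assms] by simp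
qed (use assms in blast)


section \<open>Square-free powers of edge ideals\<close>

definition sqfree_exp :: "'v set \<Rightarrow> ('v \<Rightarrow>\<^sub>0 nat)" where
  "sqfree_exp A = (\<Sum>v\<in>A. Poly_Mapping.single v 1)"

lemma lookup_sqfree_exp: "finite A \<Longrightarrow> Poly_Mapping.lookup (sqfree_exp A) v = (if v \<in> A then 1 else 0)"
  by (simp add: sqfree_exp_def lookup_sum lookup_single when_def)

lemma keys_sqfree_exp: "finite A \<Longrightarrow> Poly_Mapping.keys (sqfree_exp A) = A"
  by (auto simp: in_keys_iff lookup_sqfree_exp split: if_splits)

lemma monom_deg_sqfree_exp: "finite A \<Longrightarrow> monom_deg (sqfree_exp A) = card A"
  by (simp add: monom_deg_def keys_sqfree_exp lookup_sqfree_exp)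

lemma mono_dvd_sqfree_exp: "finite A \<Longrightarrow> mono_dvd (sqfree_exp A) m \<longleftrightarrow> A \<subseteq> Poly_Mapping.keys m"
  by (auto simp: mono_dvd_iff_lookup lookup_sqfree_exp in_keys_iff Suc_le_eq)

lemma prod_indet: "finite A \<Longrightarrow> (\<Prod>v\<in>A. indet v) = Poly_Mapping.single (sqfree_exp A) 1"
  by (induction A rule: finite_induct) (simp_all add: sqfree_exp_def indet_def mult_single)

lemma mpoly_sum_monomials:
  "f = (\<Sum>m\<in>Poly_Mapping.keys f. Poly_Mapping.single m (Poly_Mapping.lookup f m))"
  by (rule poly_mapping_eqI) (simp add: lookup_sum lookup_single when_def in_keys_iff)

lemma a_inv_mpoly_ring:
  assumes "p \<in> carrier (mpoly_ring V)"
  shows "\<ominus>\<^bsub>mpoly_ring V\<^esub> p = - p"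
proof -
  interpret cring "mpoly_ring V" by (rule mpoly_ring_cring)
  show ?thesis
    by (rule minus_equality) (use assms mpoly_ring_closed(3) in \<open>auto simp: mpoly_ring_simps(2-)\<close>)
qed

lemma mpoly_idealI:
  assumes sub: "I \<subseteq> carrier (mpoly_ring V)" and zero: "0 \<in> I"
    and add: "\<And>p q. p \<in> I \<Longrightarrow> q \<in> I \<Longrightarrow> p + q \<in> I"
    and mult: "\<And>p q. p \<in> I \<Longrightarrow> q \<in> carrier (mpoly_ring V) \<Longrightarrow> q * p \<in> I"
  shows "ideal I (mpoly_ring V)"
proof -
  interpret cring "mpoly_ring V" by (rule mpoly_ring_cring)
  have neg: "- p \<in> I" if "p \<in> I" for p
    using mult[OF that, of "- 1"] mpoly_ring_closed(2,3) by auto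
  show ?thesis
  proof (rule idealI[OF ring_axioms])
    show "subgroup I (add_monoid (mpoly_ring V))"
    proof (rule add.subgroupI)
      fix p assume "p \<in> I"
      then show "\<ominus>\<^bsub>mpoly_ring V\<^esub> p \<in> I" using a_inv_mpoly_ring neg sub by (metis subsetD)
    qed (use sub zero add in \<open>auto simp: mpoly_ring_simps(2-)\<close>)
  qed (use mult in \<open>auto simp: mpoly_ring_simps(2-) mult.commute\<close>)
qed

lemma monomial_ideal:
  fixes P :: "('v \<Rightarrow>\<^sub>0 nat) \<Rightarrow> bool"
  assumes P: "\<And>a m. P m \<Longrightarrow> P (a + m)"
  shows "ideal {p \<in> carrier (mpoly_ring V). \<forall>m\<in>Poly_Mapping.keys p. P m} (mpoly_ring V :: ('v, 'k::field) mpoly ring)"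
  (is "ideal ?J _")
proof (rule mpoly_idealI)
  fix p q :: "('v, 'k) mpoly" assume p: "p \<in> ?J" and q: "q \<in> carrier (mpoly_ring V)"
  have "P m" if m: "m \<in> Poly_Mapping.keys (q * p)" for m
  proof -
    obtain a b where "b \<in> Poly_Mapping.keys p" "m = a + b"
      using m Poly_Mapping.keys_mult[of q p] by blast
    then show ?thesis using p P by simp
  qed
  then show "q * p \<in> ?J" using p q mpoly_ring_closed(5) by blast
next
  fix p q :: "('v, 'k) mpoly" assume pq: "p \<in> ?J" "q \<in> ?J"
  then have "P m" if "m \<in> Poly_Mapping.keys (p + q)" for m
    using that Poly_Mapping.keys_add[of p q] by blast
  then show "p + q \<in> ?J" using pq mpoly_ring_closed(4)[of p V q] by simp
qed (auto simp: mpoly_ring_closed)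

lemma ideal_sum:
  assumes "ideal I (mpoly_ring V)" "\<And>x. x \<in> X \<Longrightarrow> f x \<in> I"
  shows "sum f X \<in> I"
  using assms(2)
proof (induction X rule: infinite_finite_induct)
  case (insert x X)
  then show ?case
    using additive_subgroup.a_closed[OF ideal.axioms(1)[OF assms(1)], of "f x" "sum f X"]
    by (simp add: mpoly_ring_simps)
qed (use additive_subgroup.zero_closed[OF ideal.axioms(1)[OF assms(1)]] in \<open>simp_all add: mpoly_ring_simps\<close>)

lemma ideal_multiple_closed:
  "ideal I (mpoly_ring V) \<Longrightarrow> p \<in> I \<Longrightarrow> q \<in> carrier (mpoly_ring V) \<Longrightarrow> q * p \<in> I"
  using ideal.I_l_closed[of I "mpoly_ring V" p q] by (simp add: mpoly_ring_simps)

lemma ideals_set_pow_0: "I [^]\<^bsub>ideals_set R\<^esub> (0::nat) = carrier R"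
  by (simp add: nat_pow_def ideals_set_def)

lemma ideals_set_pow_Suc: "I [^]\<^bsub>ideals_set R\<^esub> (Suc k) = ideal_prod R (I [^]\<^bsub>ideals_set R\<^esub> k) I"
  by (simp add: nat_pow_def ideals_set_def)

section \<open>Monomials in powers of the edge ideal\<close>

locale disjoint_hypergraph =
  fixes H :: "'v hypergraph"
  assumes hypergraph: "hypergraph H"
    and disjoint: "e \<in> edges H \<Longrightarrow> f \<in> edges H \<Longrightarrow> e \<noteq> f \<Longrightarrow> e \<inter> f = {}"
begin

lemma finite_verts: "finite (verts H)"
  and edge_nonempty: "e \<in> edges H \<Longrightarrow> e \<noteq> {}"
  and edge_subset: "e \<in> edges H \<Longrightarrow> e \<subseteq> verts H"
  using hypergraph by (auto simp: hypergraph_def)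

lemma finite_edge: "e \<in> edges H \<Longrightarrow> finite e"
  using edge_subset finite_verts finite_subset by blast

lemma finite_edges: "finite (edges H)"
  by (rule finite_subset[of _ "Pow (verts H)"]) (use edge_subset finite_verts in auto)

lemma finite_Union_edges: "S \<subseteq> edges H \<Longrightarrow> finite (\<Union>S)"
  using finite_edges finite_edge finite_subset by (metis finite_Union subsetD)

lemma Union_edges_subset: "S \<subseteq> edges H \<Longrightarrow> \<Union>S \<subseteq> verts H"
  using edge_subset by blast

text \<open>Since the edges are disjoint, the largest \<open>k\<close> such that a monomial lies in \<open>I(H)\<^sup>k\<close> is the sum
  over all edges of the least exponent on the edge.\<close>

definition edge_order :: "('v \<Rightarrow>\<^sub>0 nat) \<Rightarrow> nat" where
  "edge_order m = (\<Sum>e\<in>edges H. Min (Poly_Mapping.lookup m ` e))"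

lemma edge_order_add: "edge_order a + edge_order b \<le> edge_order (a + b)"
  unfolding edge_order_def sum.distrib[symmetric]
proof (rule sum_mono)
  fix e assume e: "e \<in> edges H"
  have "Min (Poly_Mapping.lookup a ` e) + Min (Poly_Mapping.lookup b ` e) \<le> Poly_Mapping.lookup (a + b) v" if "v \<in> e" for v
    unfolding lookup_add using finite_edge[OF e] that by (intro add_mono Min_le) auto
  then show "Min (Poly_Mapping.lookup a ` e) + Min (Poly_Mapping.lookup b ` e) \<le> Min (Poly_Mapping.lookup (a + b) ` e)"
    using finite_edge[OF e] edge_nonempty[OF e] by (intro Min.boundedI) auto
qed

lemma edge_order_edge: "e \<in> edges H \<Longrightarrow> 1 \<le> edge_order (sqfree_exp e)"
proof -
  assume e: "e \<in> edges H"
  have "Poly_Mapping.lookup (sqfree_exp e) ` e = {1}"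
    using finite_edge[OF e] edge_nonempty[OF e] by (auto simp: lookup_sqfree_exp)
  then have "1 = Min (Poly_Mapping.lookup (sqfree_exp e) ` e)" by simp
  also have "\<dots> \<le> edge_order (sqfree_exp e)"
    unfolding edge_order_def by (rule member_le_sum[OF e]) (use finite_edges in auto)
  finally show ?thesis .
qed

text \<open>Each minimum is at most 1, and it is 0 as soon as some vertex of the edge is missing
  from the support.\<close>

lemma edge_order_squarefree:
  assumes "\<forall>v. Poly_Mapping.lookup m v \<le> 1"
  shows "edge_order m \<le> card {e \<in> edges H. e \<subseteq> Poly_Mapping.keys m}"
proof -
  have "Min (Poly_Mapping.lookup m ` e) \<le> (if e \<subseteq> Poly_Mapping.keys m then 1 else 0)" if e: "e \<in> edges H" for e
  proof (cases "e \<subseteq> Poly_Mapping.keys m")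
    case True
    obtain v where "v \<in> e" using edge_nonempty[OF e] by blast
    then have "Min (Poly_Mapping.lookup m ` e) \<le> Poly_Mapping.lookup m v"
      using finite_edge[OF e] by (intro Min_le) auto
    also have "\<dots> \<le> 1" using assms by simp
    finally show ?thesis using True by simp
  next
    case False
    then obtain v where v: "v \<in> e" "v \<notin> Poly_Mapping.keys m" by blast
    then have "0 \<in> Poly_Mapping.lookup m ` e" by (auto simp: in_keys_iff intro!: image_eqI[OF _ v(1)])
    then have "Min (Poly_Mapping.lookup m ` e) \<le> 0" using finite_edge[OF e] by (intro Min_le) auto
    then show ?thesis by simp
  qed
  then have "edge_order m \<le> (\<Sum>e\<in>edges H. if e \<subseteq> Poly_Mapping.keys m then 1 else 0)"
    unfolding edge_order_def by (rule sum_mono)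
  also have "\<dots> = card {e \<in> edges H. e \<subseteq> Poly_Mapping.keys m}"
    using sum.inter_filter[OF finite_edges, of "\<lambda>_. 1 :: nat" "\<lambda>e. e \<subseteq> Poly_Mapping.keys m"] by simp
  finally show ?thesis .
qed

lemma order_ideal:
  "ideal {p \<in> carrier (mpoly_ring (verts H)). \<forall>m\<in>Poly_Mapping.keys p. k \<le> edge_order m} (mpoly_ring (verts H))"
proof (rule monomial_ideal)
  fix a m assume "k \<le> edge_order m"
  then show "k \<le> edge_order (a + m)" using edge_order_add[of a m] by simp
qed

lemma edge_ideal_generators:
  "{\<Prod>v\<in>e. indet v | e. e \<in> edges H} = {Poly_Mapping.single (sqfree_exp e) 1 | e. e \<in> edges H}"
  using prod_indet finite_edge by metis

lemma sqfree_carrier: "finite A \<Longrightarrow> A \<subseteq> verts H \<Longrightarrow> Poly_Mapping.single (sqfree_exp A) 1 \<in> carrier (mpoly_ring (verts H))"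
  by (simp add: mpoly_ring_simps keys_sqfree_exp)

lemma edge_ideal_order:
  assumes "f \<in> edge_ideal H"
  shows "f \<in> carrier (mpoly_ring (verts H))" "\<forall>m\<in>Poly_Mapping.keys f. 1 \<le> edge_order m"
proof -
  interpret cring "mpoly_ring (verts H)" by (rule mpoly_ring_cring)
  have "edge_ideal H \<subseteq> {p \<in> carrier (mpoly_ring (verts H)). \<forall>m\<in>Poly_Mapping.keys p. 1 \<le> edge_order m}"
    unfolding edge_ideal_def edge_ideal_generators
    by (rule genideal_minimal[OF order_ideal])
       (use edge_order_edge in \<open>auto intro!: sqfree_carrier finite_edge dest: edge_subset\<close>)
  then show "f \<in> carrier (mpoly_ring (verts H))" "\<forall>m\<in>Poly_Mapping.keys f. 1 \<le> edge_order m"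
    using assms by blast+
qed

lemma edge_in_edge_ideal: "e \<in> edges H \<Longrightarrow> Poly_Mapping.single (sqfree_exp e) 1 \<in> edge_ideal H"
proof -
  interpret cring "mpoly_ring (verts H)" by (rule mpoly_ring_cring)
  assume "e \<in> edges H"
  then show ?thesis
    unfolding edge_ideal_def edge_ideal_generators
    using genideal_self[of "{Poly_Mapping.single (sqfree_exp e) 1 | e. e \<in> edges H}"]
      sqfree_carrier finite_edge edge_subset by blast
qed

text \<open>Products add up the orders of their factors at least, by \<open>edge_order_add\<close>,
  and sums create no new monomials.\<close>

lemma edge_ideal_pow_order:
  fixes f :: "('v, 'k::field) mpoly"
  assumes "f \<in> edge_ideal H [^]\<^bsub>ideals_set (mpoly_ring (verts H))\<^esub> k"
  shows "f \<in> carrier (mpoly_ring (verts H)) \<and> (\<forall>m\<in>Poly_Mapping.keys f. k \<le> edge_order m)"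
  using assms
proof (induction k arbitrary: f)
  case 0
  then show ?case unfolding ideals_set_pow_0 by simp
next
  case (Suc k)
  from Suc.prems[unfolded ideals_set_pow_Suc] show ?case
  proof (induction rule: ideal_prod.induct)
    case (prod i j)
    have "Suc k \<le> edge_order m" if m: "m \<in> Poly_Mapping.keys (i * j)" for m
    proof -
      obtain a b where ab: "a \<in> Poly_Mapping.keys i" "b \<in> Poly_Mapping.keys j" "m = a + b"
        using m Poly_Mapping.keys_mult[of i j] by blast
      have "k \<le> edge_order a" "1 \<le> edge_order b"
        using Suc.IH[OF prod(1)] edge_ideal_order(2)[OF prod(2)] ab by auto
      then show ?thesis using edge_order_add[of a b] ab by simp
    qed
    then show ?case
      using Suc.IH[OF prod(1)] edge_ideal_order(1)[OF prod(2)] mpoly_ring_closed(5)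
      by (auto simp: mpoly_ring_simps(2))
  next
    case (sum s t)
    then show ?case
      using Poly_Mapping.keys_add[of s t] mpoly_ring_closed(4)[of s "verts H" t]
      by (auto simp: mpoly_ring_simps(4))
  qed
qed

text \<open>The edges of \<open>S\<close> are disjoint, so the exponent of their union is the sum of
  their exponents and the monomial is a product of \<open>card S\<close> generators.\<close>

lemma sqfree_exp_in_pow:
  assumes "S \<subseteq> edges H"
  shows "Poly_Mapping.single (sqfree_exp (\<Union>S)) 1 \<in> (edge_ideal H :: ('v, 'k::field) mpoly set) [^]\<^bsub>ideals_set (mpoly_ring (verts H))\<^esub> card S"
proof -
  have "finite S" using assms finite_edges finite_subset by blast
  then show ?thesis using assms
  proof (induction S rule: finite_induct)
    case empty
    show ?case unfolding card.empty ideals_set_pow_0 by (rule sqfree_carrier) simp_all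
  next
    case (insert e S)
    have "e \<inter> \<Union>S = {}" using insert.hyps insert.prems disjoint by blast
    moreover have "finite e" "finite (\<Union>S)" using insert.prems finite_edge finite_Union_edges by auto
    ultimately have "sqfree_exp (\<Union>(insert e S)) = sqfree_exp (\<Union>S) + sqfree_exp e"
      by (simp add: sqfree_exp_def sum.union_disjoint add.commute)
    then have eq: "Poly_Mapping.single (sqfree_exp (\<Union>(insert e S))) 1
      = Poly_Mapping.single (sqfree_exp (\<Union>S)) 1 \<otimes>\<^bsub>mpoly_ring (verts H)\<^esub> (Poly_Mapping.single (sqfree_exp e) 1 :: ('v, 'k) mpoly)"
      by (simp add: mpoly_ring_simps mult_single)
    have "Poly_Mapping.single (sqfree_exp (\<Union>S)) 1 \<in> (edge_ideal H :: ('v, 'k) mpoly set) [^]\<^bsub>ideals_set (mpoly_ring (verts H))\<^esub> card S"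
      using insert by simp
    moreover have "Poly_Mapping.single (sqfree_exp e) 1 \<in> (edge_ideal H :: ('v, 'k) mpoly set)"
      using insert.prems by (intro edge_in_edge_ideal) simp
    moreover have "card (insert e S) = Suc (card S)" using insert.hyps by simp
    ultimately show ?case
      unfolding eq by (simp only: ideals_set_pow_Suc ideal_prod.prod)
  qed
qed

text \<open>A square-free monomial of \<open>I^k\<close> has order at least \<open>k\<close> and so
  contains \<open>k\<close> edges. Conversely, the product of any \<open>k\<close> edges is a
  square-free element of \<open>I^k\<close>, and every monomial of \<open>f\<close> is a multiple of
  such a product.\<close>

lemma squarefree_power_edge_ideal:
  "squarefree_power (verts H) (edge_ideal H) k
    = {f \<in> carrier (mpoly_ring (verts H)) :: ('v, 'k::field) mpoly set.
        \<forall>m\<in>Poly_Mapping.keys f. \<exists>S\<subseteq>edges H. card S = k \<and> \<Union>S \<subseteq> Poly_Mapping.keys m}"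
  (is "_ = ?J")
proof
  interpret cring "mpoly_ring (verts H) :: ('v, 'k) mpoly ring" by (rule mpoly_ring_cring)
  let ?R = "mpoly_ring (verts H) :: ('v, 'k) mpoly ring"
  let ?G = "{p \<in> (edge_ideal H :: ('v, 'k) mpoly set) [^]\<^bsub>ideals_set ?R\<^esub> k. squarefree_monomial p}"
  have G: "?G \<subseteq> carrier ?R" using edge_ideal_pow_order by blast
  have J_ideal: "ideal ?J ?R"
  proof (rule monomial_ideal)
    fix a m :: "'v \<Rightarrow>\<^sub>0 nat" assume "\<exists>S\<subseteq>edges H. card S = k \<and> \<Union>S \<subseteq> Poly_Mapping.keys m"
    then obtain S where "S \<subseteq> edges H" "card S = k" "\<Union>S \<subseteq> Poly_Mapping.keys m" by (elim exE conjE)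
    then show "\<exists>S\<subseteq>edges H. card S = k \<and> \<Union>S \<subseteq> Poly_Mapping.keys (a + m)"
      by (intro exI[of _ S]) (auto simp: keys_add_nat)
  qed
  show "squarefree_power (verts H) (edge_ideal H) k \<subseteq> ?J"
    unfolding squarefree_power_def
  proof (rule genideal_minimal[OF J_ideal], rule subsetI)
    fix p assume p: "p \<in> ?G"
    then obtain m where m: "p = Poly_Mapping.single m 1" "\<forall>v. Poly_Mapping.lookup m v \<le> 1"
      by (auto simp: squarefree_monomial_def)
    have "k \<le> edge_order m" using edge_ideal_pow_order[of p k] p m by simp
    then have "k \<le> card {e \<in> edges H. e \<subseteq> Poly_Mapping.keys m}"
      using edge_order_squarefree[OF m(2)] by simp
    then obtain S where "S \<subseteq> {e \<in> edges H. e \<subseteq> Poly_Mapping.keys m}" "card S = k"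
      by (rule obtain_subset_with_card_n)
    then have "S \<subseteq> edges H \<and> card S = k \<and> \<Union>S \<subseteq> Poly_Mapping.keys m" by blast
    then have "\<exists>S\<subseteq>edges H. card S = k \<and> \<Union>S \<subseteq> Poly_Mapping.keys m" by (rule exI)
    then show "p \<in> ?J" using m(1) subsetD[OF G p] by simp
  qed
  show "?J \<subseteq> squarefree_power (verts H) (edge_ideal H) k"
  proof
    fix f assume f: "f \<in> ?J"
    have ideal: "ideal (Idl\<^bsub>?R\<^esub> ?G) ?R" by (rule genideal_ideal[OF G])
    have "Poly_Mapping.single m (Poly_Mapping.lookup f m) \<in> Idl\<^bsub>?R\<^esub> ?G" if m: "m \<in> Poly_Mapping.keys f" for m
    proof -
      obtain S where S: "S \<subseteq> edges H" "card S = k" "\<Union>S \<subseteq> Poly_Mapping.keys m" using f m by blast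
      note fin = finite_Union_edges[OF S(1)]
      obtain r where r: "m = r + sqfree_exp (\<Union>S)"
        using S(3) mono_dvd_sqfree_exp[OF fin, of m] by (auto simp: mono_dvd_def add.commute)
      have "Poly_Mapping.keys m \<subseteq> verts H" using f m by (auto simp: mpoly_ring_simps)
      then have "Poly_Mapping.single r (Poly_Mapping.lookup f m) \<in> carrier ?R"
        by (simp add: mpoly_ring_simps r keys_add_nat)
      moreover have "Poly_Mapping.single (sqfree_exp (\<Union>S)) 1 \<in> ?G"
        using sqfree_exp_in_pow[OF S(1)] S(2) lookup_sqfree_exp[OF fin]
        unfolding squarefree_monomial_def by auto
      then have "Poly_Mapping.single (sqfree_exp (\<Union>S)) 1 \<in> Idl\<^bsub>?R\<^esub> ?G" using genideal_self[OF G] by blast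
      ultimately have "Poly_Mapping.single r (Poly_Mapping.lookup f m) * Poly_Mapping.single (sqfree_exp (\<Union>S)) 1 \<in> Idl\<^bsub>?R\<^esub> ?G"
        using ideal_multiple_closed[OF ideal] by blast
      then show ?thesis by (simp add: mult_single flip: r)
    qed
    then have "(\<Sum>m\<in>Poly_Mapping.keys f. Poly_Mapping.single m (Poly_Mapping.lookup f m)) \<in> Idl\<^bsub>?R\<^esub> ?G"
      by (rule ideal_sum[OF ideal])
    then show "f \<in> squarefree_power (verts H) (edge_ideal H) k"
      unfolding squarefree_power_def using mpoly_sum_monomials[of f] by simp
  qed
qed

end


section \<open>The resolution of the square-free power\<close>

context disjoint_hypergraph
begin

section \<open>Matchings of pairwise disjoint edges\<close>

lemma card_Union_edges: "S \<subseteq> edges H \<Longrightarrow> card (\<Union>S) = (\<Sum>e\<in>S. card e)"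
  by (rule card_Union_disjoint) (auto simp: pairwise_def disjnt_def dest: disjoint finite_edge subsetD)

lemma card_Union_minus_mono:
  assumes "S \<subseteq> T" "T \<subseteq> edges H"
  shows "int (card (\<Union>S)) - int (card S) \<le> int (card (\<Union>T)) - int (card T)"
proof -
  have fin: "finite T" using assms finite_edges finite_subset by blast
  have eq: "int (card (\<Union>X)) - int (card X) = (\<Sum>e\<in>X. int (card e) - 1)" if "X \<subseteq> edges H" for X
    using card_Union_edges[OF that] by (simp add: sum_subtractf)
  have "(\<Sum>e\<in>S. int (card e) - 1) \<le> (\<Sum>e\<in>T. int (card e) - 1)"
  proof (rule sum_mono2[OF fin assms(1)])
    fix e assume "e \<in> T - S"
    then have "0 < card e" using assms finite_edge edge_nonempty by (auto simp: card_gt_0_iff)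
    then show "0 \<le> int (card e) - 1" by simp
  qed
  then show ?thesis using eq assms by auto
qed

lemma matching_iff: "matching H M \<longleftrightarrow> M \<subseteq> edges H"
  by (auto simp: matching_def pairwise_def disjnt_def dest: disjoint subsetD)

lemma matching_number_eq: "matching_number H = card (edges H)"
  unfolding matching_number_def matching_iff
proof (rule Max_eqI)
  show "finite {card M | M. M \<subseteq> edges H}"
    using finite_edges by (simp add: setcompr_eq_image flip: Pow_def)
qed (use finite_edges card_mono in auto)

lemma generalized_admissible_edges:
  assumes "1 \<le> k" "k \<le> card (edges H)"
  shows "generalized_admissible_matching H k (edges H)"
  unfolding generalized_admissible_matching_def
proof (intro conjI exI[of _ "(\<lambda>e. {e}) ` edges H"])
  show "partition_on (edges H) ((\<lambda>e. {e}) ` edges H)"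
    by (auto simp: partition_on_def disjoint_def)
  have "card ((\<lambda>e. {e}) ` edges H) = card (edges H)" by (rule card_image) simp
  \<comment> \<open>There are as many parts as edges, so the bound comes down to
    \<open>1 \<le> k\<close>.\<close>
  then show "card (edges H) \<le> card ((\<lambda>e. {e}) ` edges H) + k - 1" using assms by simp
  show "\<forall>N\<in>(\<lambda>e. {e}) ` edges H. \<forall>N'. matching (induced H (\<Union>N)) N' \<and> card N' = card N \<longrightarrow> \<Union>N' = \<Union>N"
  proof (intro ballI allI impI)
    fix N N' assume "N \<in> (\<lambda>e. {e}) ` edges H" and N': "matching (induced H (\<Union>N)) N' \<and> card N' = card N"
    then obtain e where e: "e \<in> edges H" "N = {e}" by blast
    then obtain f where f: "N' = {f}" using N' by (auto simp: card_1_singleton_iff)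
    then have "f \<in> edges H" "f \<subseteq> e" using N' e by (auto simp: matching_def induced_def)
    \<comment> \<open>No edge properly contains another, so \<open>e\<close> is the only edge inside
      \<open>e\<close>.\<close>
    then have "f = e" using hypergraph e(1) by (auto simp: hypergraph_def)
    then show "\<Union>N' = \<Union>N" using e f by simp
  qed
qed (use assms in \<open>auto simp: matching_iff induced_def\<close>)

lemma Max_generalized_admissible:
  assumes "1 \<le> k" "k \<le> card (edges H)"
  shows "Max {int (card (\<Union>M)) - int (card M) | M. generalized_admissible_matching H k M}
    = int (card (\<Union>(edges H))) - int (card (edges H))"
proof (rule Max_eqI)
  have sub: "M \<subseteq> edges H" if "generalized_admissible_matching H k M" for M
    using that by (simp add: generalized_admissible_matching_def matching_iff)
  show "finite {int (card (\<Union>M)) - int (card M) | M. generalized_admissible_matching H k M}"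
    by (rule finite_subset[of _ "(\<lambda>M. int (card (\<Union>M)) - int (card M)) ` Pow (edges H)"])
       (use sub finite_edges in auto)
  show "y \<le> int (card (\<Union>(edges H))) - int (card (edges H))"
    if "y \<in> {int (card (\<Union>M)) - int (card M) | M. generalized_admissible_matching H k M}" for y
    using that sub card_Union_minus_mono by blast
qed (use generalized_admissible_edges[OF assms] in blast)

end

text \<open>The signs and the cone points presuppose a linear order on the edges, which the
  numbering supplies.\<close>

locale enumerated_hypergraph = disjoint_hypergraph H
  for H :: "'v hypergraph" +
  fixes edge :: "nat \<Rightarrow> 'v set" and n k :: nat
  assumes edge: "bij_betw edge {..<n} (edges H)"
    and k: "1 \<le> k" "k \<le> n"
begin

section \<open>Multidegrees indexed by sets of edges\<close>

definition mdeg :: "nat set \<times> nat set \<Rightarrow> ('v \<Rightarrow>\<^sub>0 nat)" where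
  "mdeg q = sqfree_exp (\<Union>(edge ` fst q))"

definition basis :: "nat \<Rightarrow> (nat set \<times> nat set) list" where
  "basis i = (SOME xs. set xs = level_basis k {..<n} i \<and> distinct xs)"

lemma basis: "set (basis i) = level_basis k {..<n} i" "distinct (basis i)"
proof -
  have "finite (level_basis k {..<n} i)"
    by (cases i) (auto simp: level_basis_def finite_strand_basis)
  from someI_ex[OF finite_distinct_list[OF this]]
  show "set (basis i) = level_basis k {..<n} i" "distinct (basis i)" by (auto simp: basis_def)
qed

lemma edge_in: "j < n \<Longrightarrow> edge j \<in> edges H"
  using edge by (auto simp: bij_betw_def)

lemma edge_image: "S \<subseteq> {..<n} \<Longrightarrow> edge ` S \<subseteq> edges H"
  using edge_in by auto

lemma card_edge_image: "S \<subseteq> {..<n} \<Longrightarrow> card (edge ` S) = card S"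
  using edge by (auto simp: bij_betw_def intro: card_image inj_on_subset)

lemma level_basis_subset: "q \<in> level_basis k {..<n} i \<Longrightarrow> fst q \<subseteq> {..<n}"
  by (cases i) (auto simp: level_basis_def strand_basis_def)

lemma keys_mdeg: "fst q \<subseteq> {..<n} \<Longrightarrow> Poly_Mapping.keys (mdeg q) = \<Union>(edge ` fst q)"
  unfolding mdeg_def by (rule keys_sqfree_exp[OF finite_Union_edges[OF edge_image]])

definition support :: "('v \<Rightarrow>\<^sub>0 nat) \<Rightarrow> nat set" where
  "support m = {j \<in> {..<n}. edge j \<subseteq> Poly_Mapping.keys m}"

lemma mono_dvd_mdeg: "fst q \<subseteq> {..<n} \<Longrightarrow> mono_dvd (mdeg q) m \<longleftrightarrow> fst q \<subseteq> support m"
  unfolding mdeg_def mono_dvd_sqfree_exp[OF finite_Union_edges[OF edge_image]] support_def by auto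

text \<open>The strand in degree \<open>m\<close> is the scalar complex on the edges inside the
  support of \<open>m\<close>, because \<open>strand_basis\<close> refers to its ambient set only
  through containment.\<close>

lemma level_basis_dvd:
  "{q. q \<in> set (basis i) \<and> mono_dvd (mdeg q) m} = level_basis k (support m) i"
proof -
  have "{q. q \<in> set (basis i) \<and> mono_dvd (mdeg q) m} = {q \<in> level_basis k {..<n} i. fst q \<subseteq> support m}"
    using mono_dvd_mdeg[OF level_basis_subset] basis(1) by blast
  also have "\<dots> = level_basis k (support m) i"
  proof (cases i)
    case (Suc i')
    have "support m \<subseteq> {..<n}" by (auto simp: support_def)
    from strand_basis_restrict[OF this, of k "k + i'"] Suc show ?thesis by (simp add: level_basis_def)
  qed (auto simp: level_basis_def)
  finally show ?thesis .
qed

text \<open>A vertex of an additional edge lies on none of the edges in \<open>S\<close>, so the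
  exponent strictly grows.\<close>

lemma mdeg_psubset:
  assumes "S \<subset> fst q" "fst q \<subseteq> {..<n}"
  shows "mono_dvd (mdeg (S, U)) (mdeg q)" "mdeg (S, U) \<noteq> mdeg q"
proof -
  have S: "S \<subseteq> {..<n}" using assms by auto
  have "S \<subseteq> support (mdeg q)"
    using assms keys_mdeg[OF assms(2)] by (auto simp: support_def)
  then show "mono_dvd (mdeg (S, U)) (mdeg q)" using S by (simp add: mono_dvd_mdeg)
  obtain j where j: "j \<in> fst q" "j \<notin> S" using assms by blast
  obtain v where v: "v \<in> edge j" using edge_nonempty[OF edge_in] j assms by blast
  have "v \<notin> edge l" if l: "l \<in> S" for l
  proof
    assume "v \<in> edge l"
    then have "edge l = edge j" using disjoint[OF edge_in edge_in, of l j] v l S j assms by blast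
    then have "l = j" using edge l S j assms unfolding bij_betw_def inj_on_def by blast
    then show False using l j by simp
  qed
  then have "v \<notin> Poly_Mapping.keys (mdeg (S, U))" using S by (simp add: keys_mdeg)
  moreover have "v \<in> Poly_Mapping.keys (mdeg q)" using v j assms(2) by (auto simp: keys_mdeg)
  ultimately show "mdeg (S, U) \<noteq> mdeg q" by metis
qed

text \<open>Nonzero coefficients strictly enlarge the edge set, which settles divisibility and
  minimality. Exactness in degree \<open>m\<close> is \<open>level_exact\<close> for the edge set
  \<open>support m\<close>.\<close>

sublocale scalar_complex "verts H" basis mdeg "level_coeff {..<n} :: nat \<Rightarrow> _ \<Rightarrow> _ \<Rightarrow> 'k::field"
proof
  fix i
  show "distinct (basis i)" by (rule basis)
  show "Poly_Mapping.keys (mdeg q) \<subseteq> verts H" if "q \<in> set (basis i)" for q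
    using that level_basis_subset[of q i] keys_mdeg[of q] Union_edges_subset[OF edge_image[of "fst q"]] basis(1) by simp
  have "set (basis 0) = {({}, {})}" using basis(1)[of 0] by (simp add: level_basis_def)
  moreover from this have "length (basis 0) = Suc 0" using distinct_card[OF basis(2)[of 0]] by simp
  then obtain b where "basis 0 = [b]" by (auto simp: length_Suc_conv)
  ultimately have "basis 0 = [({}, {})]" by simp
  then show "map mdeg (basis 0) = [0]" by (simp add: mdeg_def sqfree_exp_def)
next
  fix p q i assume pq: "p \<in> set (basis i)" "q \<in> set (basis (Suc i))" "(level_coeff {..<n} i p q :: 'k) \<noteq> 0"
  show "mono_dvd (mdeg p) (mdeg q)"
  proof (cases i)
    case 0
    then show ?thesis using pq by (simp add: basis level_basis_def mdeg_def sqfree_exp_def mono_dvd_def)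
  next
    case (Suc i')
    then have "fst p \<subset> fst q" using pq(3) restr_diff_unit_chain_support[of "{..<n}" q "fst p" "snd p"]
      by (simp add: level_coeff_def)
    then show ?thesis using mdeg_psubset(1)[of "fst p" q "snd p"] level_basis_subset[of q "Suc i"] pq(2) basis(1) by simp
  qed
next
  fix p q i assume pq: "p \<in> set (basis (Suc i))" "q \<in> set (basis (Suc (Suc i)))" "(level_coeff {..<n} (Suc i) p q :: 'k) \<noteq> 0"
  then have "fst p \<subset> fst q" using restr_diff_unit_chain_support[of "{..<n}" q "fst p" "snd p"]
    by (simp add: level_coeff_def)
  then show "mdeg p \<noteq> mdeg q"
    using mdeg_psubset(2)[of "fst p" q "snd p"] level_basis_subset[of q "Suc (Suc i)"] pq(2) basis(1) by simp
next
  fix p r i assume "p \<in> set (basis i)" "r \<in> set (basis (Suc (Suc i)))"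
  then show "(\<Sum>q\<in>set (basis (Suc i)). level_coeff {..<n} i p q * level_coeff {..<n} (Suc i) q r) = (0 :: 'k)"
    unfolding basis(1) by (intro level_complex k(1)) auto
next
  fix m i and t :: "nat set \<times> nat set \<Rightarrow> 'k"
  assume t: "\<And>p. p \<in> set (basis i) \<Longrightarrow> mono_dvd (mdeg p) m \<Longrightarrow>
    (\<Sum>q | q \<in> set (basis (Suc i)) \<and> mono_dvd (mdeg q) m. level_coeff {..<n} i p q * t q) = 0"
  have "\<exists>x. \<forall>q\<in>level_basis k (support m) (Suc i). t q
    = (\<Sum>r\<in>level_basis k (support m) (Suc (Suc i)). level_coeff {..<n} (Suc i) q r * x r)"
  proof (rule level_exact[OF _ k(1)])
    fix p assume "p \<in> level_basis k (support m) i"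
    then have "p \<in> set (basis i)" "mono_dvd (mdeg p) m" unfolding level_basis_dvd[symmetric] by auto
    from t[OF this] show "(\<Sum>q\<in>level_basis k (support m) (Suc i). level_coeff {..<n} i p q * t q) = 0"
      unfolding level_basis_dvd .
  qed (auto simp: support_def)
  then show "\<exists>x. \<forall>q. q \<in> set (basis (Suc i)) \<longrightarrow> mono_dvd (mdeg q) m \<longrightarrow>
    t q = (\<Sum>r | r \<in> set (basis (Suc (Suc i))) \<and> mono_dvd (mdeg r) m. level_coeff {..<n} (Suc i) q r * x r)"
    unfolding level_basis_dvd[symmetric] by (simp only: Ball_def mem_Collect_eq imp_conjL)
qed (simp add: level_coeff_def)

lemma generators_iff:
  "(\<exists>q\<in>set (basis (Suc 0)). mono_dvd (mdeg q) m) \<longleftrightarrow> (\<exists>S\<subseteq>edges H. card S = k \<and> \<Union>S \<subseteq> Poly_Mapping.keys m)"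
  (is "?L \<longleftrightarrow> ?R")
proof -
  have basis1: "set (basis (Suc 0)) = (\<lambda>S. (S, S)) ` {S. S \<subseteq> {..<n} \<and> card S = k}"
    unfolding basis(1) level_basis_def using strand_basis_least[of "{..<n}" k] k by simp
  show ?thesis
  proof
    assume ?L
    then obtain S where S: "S \<subseteq> {..<n}" "card S = k" "mono_dvd (mdeg (S, S)) m" unfolding basis1 by auto
    then have "\<Union>(edge ` S) \<subseteq> Poly_Mapping.keys m"
      using mono_dvd_sqfree_exp[OF finite_Union_edges[OF edge_image[OF S(1)]], of m] by (simp add: mdeg_def)
    then show ?R using S edge_image[OF S(1)] card_edge_image[OF S(1)] by (intro exI[of _ "edge ` S"]) simp
  next
    assume ?R
    then obtain T where T: "T \<subseteq> edges H" "card T = k" "\<Union>T \<subseteq> Poly_Mapping.keys m" by (elim exE conjE)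
    then obtain S where S: "S \<subseteq> {..<n}" "T = edge ` S"
      using edge by (metis bij_betw_imp_surj_on subset_imageE)
    then have "mono_dvd (mdeg (S, S)) m"
      using mono_dvd_sqfree_exp[OF finite_Union_edges[OF T(1)], of m] T(3) by (simp add: mdeg_def)
    then show ?L unfolding basis1 using S T(2) card_edge_image[OF S(1)] by auto
  qed
qed

lemma resolution:
  "minimal_graded_free_resolution (verts H)
    (squarefree_power (verts H) (edge_ideal H) k :: ('v, 'k::field) mpoly set) (\<lambda>i. degs (Suc i)) diff_mat"
  using minimal_resolution unfolding generators_iff squarefree_power_edge_ideal .

section \<open>Betti numbers and regularity\<close>

lemma monom_deg_mdeg: "fst q \<subseteq> {..<n} \<Longrightarrow> monom_deg (mdeg q) = card (\<Union>(edge ` fst q))"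
  unfolding mdeg_def by (rule monom_deg_sqfree_exp[OF finite_Union_edges[OF edge_image]])

lemma betti_nonzero_iff:
  "betti (verts H) (squarefree_power (verts H) (edge_ideal H) k :: ('v, 'k::field) mpoly set) i j \<noteq> 0
    \<longleftrightarrow> (\<exists>q\<in>strand_basis k {..<n} (k + i). j = int (card (\<Union>(edge ` fst q))))"
proof -
  have "betti (verts H) (squarefree_power (verts H) (edge_ideal H) k :: ('v, 'k) mpoly set) i j \<noteq> 0
    \<longleftrightarrow> j \<in> set (degs (Suc i))"
    unfolding betti_eq[OF resolution] by (simp add: count_list_0_iff)
  also have "\<dots> \<longleftrightarrow> (\<exists>q\<in>strand_basis k {..<n} (k + i). j = int (monom_deg (mdeg q)))"
    by (auto simp: degs_def basis(1) level_basis_def)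
  also have "\<dots> \<longleftrightarrow> (\<exists>q\<in>strand_basis k {..<n} (k + i). j = int (card (\<Union>(edge ` fst q))))"
    by (intro bex_cong refl) (auto simp: monom_deg_mdeg strand_basis_def)
  finally show ?thesis .
qed

lemma edge_all: "edge ` {..<n} = edges H"
  using edge by (rule bij_betw_imp_surj_on)

text \<open>Since \<open>card S = k + i\<close>, the value \<open>j - i\<close> is a function
  \<open>?f\<close> of \<open>S\<close> alone. This yields both the finiteness of the set and the
  upper bound.\<close>

lemma Max_betti:
  "Max {j - int i | i j. betti (verts H) (squarefree_power (verts H) (edge_ideal H) k :: ('v, 'k::field) mpoly set) i j \<noteq> 0}
    = int (card (\<Union>(edges H))) - int (card (edges H)) + int k"
proof (rule Max_eqI)
  let ?X = "{j - int i | i j. betti (verts H) (squarefree_power (verts H) (edge_ideal H) k :: ('v, 'k) mpoly set) i j \<noteq> 0}"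
  let ?f = "\<lambda>S. int (card (\<Union>(edge ` S))) - int (card (edge ` S)) + int k"
  have X: "\<exists>S\<subseteq>{..<n}. y = ?f S" if y: "y \<in> ?X" for y
  proof -
    obtain i j q where "y = j - int i" "q \<in> strand_basis k {..<n} (k + i)" "j = int (card (\<Union>(edge ` fst q)))"
      using y unfolding betti_nonzero_iff by blast
    then show ?thesis
      using card_edge_image[of "fst q"] by (intro exI[of _ "fst q"]) (auto simp: strand_basis_def)
  qed
  show "finite ?X" by (rule finite_subset[of _ "?f ` Pow {..<n}"]) (use X in blast, simp)
  fix y assume "y \<in> ?X"
  then obtain S where "S \<subseteq> {..<n}" "y = ?f S" using X by blast
  moreover have "edge ` S \<subseteq> edges H" by (rule edge_image) fact
  ultimately show "y \<le> int (card (\<Union>(edges H))) - int (card (edges H)) + int k"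
    using card_Union_minus_mono[of "edge ` S" "edges H"] by simp
next
  have "Min {..<n} = 0" using k by (intro Min_eqI) auto
  \<comment> \<open>The last step \<open>i = n - k\<close> attains the bound: the set of all indices
    is the simplex, and the face \<open>{..<k}\<close> contains its least vertex 0 because
    \<open>1 \<le> k\<close>.\<close>
  then have "({..<n}, {..<k}) \<in> strand_basis k {..<n} (k + (n - k))"
    using k by (auto simp: strand_basis_def)
  then have "betti (verts H) (squarefree_power (verts H) (edge_ideal H) k :: ('v, 'k) mpoly set) (n - k) (int (card (\<Union>(edges H)))) \<noteq> 0"
    unfolding betti_nonzero_iff by (rule bexI[rotated]) (simp add: edge_all)
  moreover have "card (edges H) = n" using bij_betw_same_card[OF edge] by simp
  then have "int (card (\<Union>(edges H))) - int (card (edges H)) + int k = int (card (\<Union>(edges H))) - int (n - k)"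
    unfolding of_nat_diff[OF k(2)] by linarith
  ultimately show "int (card (\<Union>(edges H))) - int (card (edges H)) + int k
    \<in> {j - int i | i j. betti (verts H) (squarefree_power (verts H) (edge_ideal H) k :: ('v, 'k) mpoly set) i j \<noteq> 0}"
    by (intro CollectI exI conjI)
qed

text \<open>The regularity of the zero ideal is 0 by convention, so this case has to be excluded;
  the product of the first \<open>k\<close> edges is a nonzero element.\<close>

lemma squarefree_power_nonzero: "squarefree_power (verts H) (edge_ideal H) k \<noteq> ({0} :: ('v, 'k::field) mpoly set)"
proof -
  let ?m = "sqfree_exp (\<Union>(edge ` {..<k}))"
  have S: "edge ` {..<k} \<subseteq> edges H" "card (edge ` {..<k}) = k"
    using edge_image[of "{..<k}"] card_edge_image[of "{..<k}"] k by auto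
  note fin = finite_Union_edges[OF S(1)]
  have "Poly_Mapping.single ?m (1 :: 'k) \<in> squarefree_power (verts H) (edge_ideal H) k"
    unfolding squarefree_power_edge_ideal
    using sqfree_carrier[OF fin Union_edges_subset[OF S(1)]] S keys_sqfree_exp[OF fin] by auto
  moreover have "Poly_Mapping.single ?m (1 :: 'k) \<noteq> 0"
    by (metis lookup_single_eq lookup_zero one_neq_zero)
  ultimately show ?thesis by blast
qed

lemma reg_squarefree_power:
  "reg (verts H) (squarefree_power (verts H) (edge_ideal H) k :: ('v, 'k::field) mpoly set)
    = int (card (\<Union>(edges H))) - int (card (edges H)) + int k"
  unfolding reg_def if_not_P[OF squarefree_power_nonzero] by (rule Max_betti)

end

theorem proposition3p10:
  fixes H :: "'v hypergraph" and k :: nat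
  assumes "hypergraph H"
    and "\<forall>e\<in>edges H. \<forall>f\<in>edges H. e \<noteq> f \<longrightarrow> e \<inter> f = {}"
    and "1 \<le> k" and "k \<le> matching_number H"
  shows "reg (verts H) (squarefree_power (verts H) (edge_ideal H :: ('v, 'k::field) mpoly set) k)
           = Max {int (card (\<Union>M)) - int (card M) | M. generalized_admissible_matching H k M} + int k
       \<and> Max {int (card (\<Union>M)) - int (card M) | M. generalized_admissible_matching H k M} + int k
           = int (card (\<Union>(edges H))) - int (card (edges H)) + int k"
proof -
  interpret disjoint_hypergraph H
    using assms by unfold_locales auto
  have k_le: "k \<le> card (edges H)" using assms(4) by (simp add: matching_number_eq)
  obtain edge where edge: "bij_betw edge {..<card (edges H)} (edges H)"
    using ex_bij_betw_nat_finite[OF finite_edges] by (auto simp: atLeast0LessThan)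
  interpret enumerated_hypergraph H edge "card (edges H)" k
    using edge assms(3) k_le by unfold_locales
  show ?thesis
    using reg_squarefree_power Max_generalized_admissible[OF assms(3) k_le] by simp
qed

end
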